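(* Assume that, for every $\delta>0$, there exists a family of functions $(\varphi_x)_{x\in M}\subset\mathrm{UC}_\kappa$ satisfying the following: (i) for every $x\in M$: $0\le\varphi_x(y)\le1$ for all $y\in M$, $\varphi_x(x)=0$, and $\varphi_x(y)=1$ for all $y\in M$ with $d(x,y)\ge\delta$; (ii) $\sup_{x\in M}\kappa(x)\big[(\mathscr{S}(h)\varphi_x)(x)\big]\to0$ as $h\searrow0$. Then the semigroup envelope $\mathscr{S}$ is strongly continuous, i.e. $[0,\infty)\to\mathrm{UC}_\kappa$, $t\mapsto\mathscr{S}(t)u$ is continuous (w.r.t. $\|\cdot\|_\kappa$) for all $u\in\mathrm{UC}_\kappa$.
   Context: Setting: $\Lambda$ is a nonempty set, $(M,d)$ is a separable metric space, and $\kappa\colon M\to(0,\infty)$ is continuous and bounded. $\|u\|_\infty=\sup_{x\in M}|u(x)|$; $\|u\|_\kappa=\|\kappa u\|_\infty$; $\|u\|_{\mathrm{Lip}}=\inf\{L\ge 0: |u(x)-u(y)|\le L d(x,y)\ \forall x,y\in M\}$. $\mathrm{C}_\kappa$ is the space of continuous $u\colon M\to\mathbb{R}$ with $\|u\|_\kappa<\infty$; $\mathrm{Lip}_{\rm b}$ is the space of bounded Lipschitz functions $M\to\mathbb{R}$; $\mathrm{UC}_\kappa$ is the closure of $\mathrm{Lip}_{\rm b}$ in $(\mathrm{C}_\kappa,\|\cdot\|_\kappa)$. For $u_n,u\in\mathrm{UC}_\kappa$, $u_n\nearrow u$ means $u_n\le u_{n+1}$ for all $n$ and $u_n(x)\to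 u(x)$ for all $x\in M$. A Feller semigroup is a family $T=(T(t))_{t\ge0}$ of possibly nonlinear operators such that (i) $T(t)\colon\mathrm{UC}_\kappa\to\mathrm{UC}_\kappa$ is continuous for all $t\ge 0$; (ii) $T(0)u=u$ and $T(s+t)u=T(s)T(t)u$ for all $s,t\ge0$, $u\in\mathrm{UC}_\kappa$; (iii) each $T(t)$ is monotone and continuous from below, i.e. $u_n\nearrow u$ in $\mathrm{UC}_\kappa$ implies $T(t)u_n\nearrow T(t)u$. Standing assumptions: (A1) for every $\lambda\in\Lambda$, $S_\lambda=(S_\lambda(t))_{t\ge0}$ is a Feller semigroup of linear operators with $S_\lambda(t)1=1$ for all $t\geq 0$; (A2) there are $\alpha,\beta\in\mathbb{R}$ with $\|S_\lambda(t)u\|_\kappa\le e^{\alpha t}\|u\|_\kappa$ and $\|S_\lambda(t)u\|_{\mathrm{Lip}}\le e^{\beta t}\|u\|_{\mathrm{Lip}}$ for all $u\in\mathrm{Lip}_{\rm b}$, $\lambda\in\Lambda$, $t\ge0$. For $h\ge0$, $u\in\mathrm{UC}_\kappa$: $(\mathcal{E}_hu)(x)=\sup_{\lambda\in\Lambda}(S_\lambda(h)u)(x)$; $\mathcal{E}_h$ maps $\mathrm{UC}_\kappa$ to itself. $P$ is the set of finite subsets $\pi\subset[0,\infty)$ with $0\in\pi$, and $P_t=\{\pi\in P:\max\pi=t\}$. For $\pi=\{t_0,\dots,t_m\}$ with $0=t_0<t_1<\dots<t_m$, $m\ge 1$, $\mathcal{E}_\pi u=\mathcal{E}_{t_1-t_0}\cdots\mathcal{E}_{t_m-t_{m-1}}u$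 (composition), and $\mathcal{E}_{\{0\}}u=u$. The semigroup envelope $\mathscr{S}=(\mathscr{S}(t))_{t\ge0}$ is $(\mathscr{S}(t)u)(x)=\sup_{\pi\in P_t}(\mathcal{E}_\pi u)(x)$ for $t\ge0$, $u\in\mathrm{UC}_\kappa$, $x\in M$; it is a Feller semigroup. *)

theory Defs
  imports "HOL-Analysis.Analysis"
begin

text \<open>The norms take values in \<^typ>\<open>ennreal\<close>, so that they are defined for
  every function and are infinite exactly where they should be; in particular
  \<open>lip_norm u = \<infinity>\<close> if \<open>u\<close> is not Lipschitz.\<close>

definition sup_norm :: "('a \<Rightarrow> real) \<Rightarrow> ennreal" where
  "sup_norm u = (SUP x. ennreal \<bar>u x\<bar>)"

definition kappa_norm :: "('a \<Rightarrow> real) \<Rightarrow> ('a \<Rightarrow> real) \<Rightarrow> ennreal" where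
  "kappa_norm \<kappa> u = sup_norm (\<lambda>x. \<kappa> x * u x)"

definition lip_norm :: "('a::metric_space \<Rightarrow> real) \<Rightarrow> ennreal" where
  "lip_norm u = Inf {ennreal L | L. L-lipschitz_on UNIV u}"

definition C_kappa :: "('a::metric_space \<Rightarrow> real) \<Rightarrow> ('a \<Rightarrow> real) set" where
  "C_kappa \<kappa> = {u. continuous_on UNIV u \<and> kappa_norm \<kappa> u < \<infinity>}"

definition Lip_b :: "('a::metric_space \<Rightarrow> real) set" where
  "Lip_b = {u. bounded (range u) \<and> (\<exists>L. L-lipschitz_on UNIV u)}"

definition kappa_dist :: "('a \<Rightarrow> real) \<Rightarrow> ('a \<Rightarrow> real) \<Rightarrow> ('a \<Rightarrow> real) \<Rightarrow> real" where
  "kappa_dist \<kappa> u v = enn2real (kappa_norm \<kappa> (\<lambda>x. u x - v x))"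

definition kappa_topology :: "('a::metric_space \<Rightarrow> real) \<Rightarrow> ('a \<Rightarrow> real) topology" where
  "kappa_topology \<kappa> = Metric_space.mtopology (C_kappa \<kappa>) (kappa_dist \<kappa>)"

definition UC_kappa :: "('a::metric_space \<Rightarrow> real) \<Rightarrow> ('a \<Rightarrow> real) set" where
  "UC_kappa \<kappa> = kappa_topology \<kappa> closure_of Lip_b"

definition UC_topology :: "('a::metric_space \<Rightarrow> real) \<Rightarrow> ('a \<Rightarrow> real) topology" where
  "UC_topology \<kappa> = subtopology (kappa_topology \<kappa>) (UC_kappa \<kappa>)"

definition increases_to :: "(nat \<Rightarrow> 'a \<Rightarrow> real) \<Rightarrow> ('a \<Rightarrow> real) \<Rightarrow> bool" where
  "increases_to U u \<longleftrightarrow> (\<forall>n. U n \<le> U (Suc n)) \<and> (\<forall>x. (\<lambda>n. U n x) \<longlonglongrightarrow> u x)"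

text \<open>Operators on \<open>UC_kappa \<kappa>\<close> are represented by maps on all functions; only their
  restrictions to \<open>UC_kappa \<kappa>\<close> and to times \<open>t \<ge> 0\<close> are ever constrained.\<close>

definition feller_semigroup ::
    "('a::metric_space \<Rightarrow> real) \<Rightarrow> (real \<Rightarrow> ('a \<Rightarrow> real) \<Rightarrow> 'a \<Rightarrow> real) \<Rightarrow> bool" where
  "feller_semigroup \<kappa> T \<longleftrightarrow>
     (\<forall>t\<ge>0. continuous_map (UC_topology \<kappa>) (UC_topology \<kappa>) (T t)) \<and>
     (\<forall>u\<in>UC_kappa \<kappa>. T 0 u = u) \<and>
     (\<forall>s\<ge>0. \<forall>t\<ge>0. \<forall>u\<in>UC_kappa \<kappa>. T (s + t) u = T s (T t u)) \<and>
     (\<forall>t\<ge>0. \<forall>u\<in>UC_kappa \<kappa>. \<forall>v\<in>UC_kappa \<kappa>. u \<le> v \<longrightarrow> T t u \<le> T t v) \<and>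
     (\<forall>t\<ge>0. \<forall>U. \<forall>u\<in>UC_kappa \<kappa>. (\<forall>n. U n \<in> UC_kappa \<kappa>) \<longrightarrow>
        increases_to U u \<longrightarrow> increases_to (\<lambda>n. T t (U n)) (T t u))"

definition linear_on_UC ::
    "('a::metric_space \<Rightarrow> real) \<Rightarrow> (('a \<Rightarrow> real) \<Rightarrow> 'a \<Rightarrow> real) \<Rightarrow> bool" where
  "linear_on_UC \<kappa> A \<longleftrightarrow>
     (\<forall>u\<in>UC_kappa \<kappa>. \<forall>v\<in>UC_kappa \<kappa>. A (\<lambda>x. u x + v x) = (\<lambda>x. A u x + A v x)) \<and>
     (\<forall>c. \<forall>u\<in>UC_kappa \<kappa>. A (\<lambda>x. c * u x) = (\<lambda>x. c * A u x))"

definition strongly_continuous ::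
    "('a::metric_space \<Rightarrow> real) \<Rightarrow> (real \<Rightarrow> ('a \<Rightarrow> real) \<Rightarrow> 'a \<Rightarrow> real) \<Rightarrow> bool" where
  "strongly_continuous \<kappa> T \<longleftrightarrow>
     (\<forall>u\<in>UC_kappa \<kappa>. continuous_map (top_of_set {0..}) (UC_topology \<kappa>) (\<lambda>t. T t u))"

text \<open>The suprema below are suprema in \<^typ>\<open>real\<close>. They range over nonempty sets which are
  bounded above whenever the semigroups satisfy a common bound
  \<open>kappa_norm \<kappa> (S i t u) \<le> exp (\<alpha> * t) * kappa_norm \<kappa> u\<close>.\<close>

definition sup_step ::
    "'l set \<Rightarrow> ('l \<Rightarrow> real \<Rightarrow> ('a \<Rightarrow> real) \<Rightarrow> 'a \<Rightarrow> real) \<Rightarrow> real \<Rightarrow> ('a \<Rightarrow> real) \<Rightarrow> 'a \<Rightarrow> real" where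
  "sup_step \<Lambda> S h u x = (SUP i\<in>\<Lambda>. S i h u x)"

fun sup_steps ::
    "'l set \<Rightarrow> ('l \<Rightarrow> real \<Rightarrow> ('a \<Rightarrow> real) \<Rightarrow> 'a \<Rightarrow> real) \<Rightarrow> real list \<Rightarrow> ('a \<Rightarrow> real) \<Rightarrow> 'a \<Rightarrow> real" where
  "sup_steps \<Lambda> S (s # t # ts) u = sup_step \<Lambda> S (t - s) (sup_steps \<Lambda> S (t # ts) u)"
| "sup_steps \<Lambda> S [t] u = u"
| "sup_steps \<Lambda> S [] u = u"

definition partition_op ::
    "'l set \<Rightarrow> ('l \<Rightarrow> real \<Rightarrow> ('a \<Rightarrow> real) \<Rightarrow> 'a \<Rightarrow> real) \<Rightarrow> real set \<Rightarrow> ('a \<Rightarrow> real) \<Rightarrow> 'a \<Rightarrow> real" where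
  "partition_op \<Lambda> S \<pi> = sup_steps \<Lambda> S (sorted_list_of_set \<pi>)"

definition partitions :: "real set set" where
  "partitions = {\<pi>. finite \<pi> \<and> \<pi> \<subseteq> {0..} \<and> 0 \<in> \<pi>}"

definition partitions_to :: "real \<Rightarrow> real set set" where
  "partitions_to t = {\<pi> \<in> partitions. Max \<pi> = t}"

definition semigroup_envelope ::
    "'l set \<Rightarrow> ('l \<Rightarrow> real \<Rightarrow> ('a \<Rightarrow> real) \<Rightarrow> 'a \<Rightarrow> real) \<Rightarrow> real \<Rightarrow> ('a \<Rightarrow> real) \<Rightarrow> 'a \<Rightarrow> real" where
  "semigroup_envelope \<Lambda> S t u x = (SUP \<pi>\<in>partitions_to t. partition_op \<Lambda> S \<pi> u x)"

lemma ennreal_abs_le_sup_norm: "ennreal \<bar>u x\<bar> \<le> sup_norm u"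
  unfolding sup_norm_def by (rule SUP_upper) simp

lemma sup_norm_diff_triangle:
  "sup_norm (\<lambda>x. u x - w x) \<le> sup_norm (\<lambda>x. u x - v x) + sup_norm (\<lambda>x. v x - w x)"
  unfolding sup_norm_def[of "\<lambda>x. u x - w x"]
proof (rule SUP_least)
  fix x
  have "ennreal \<bar>u x - w x\<bar> \<le> ennreal \<bar>u x - v x\<bar> + ennreal \<bar>v x - w x\<bar>"
    by (subst ennreal_plus[symmetric]) (auto simp del: ennreal_plus intro!: ennreal_leI)
  also have "\<dots> \<le> sup_norm (\<lambda>x. u x - v x) + sup_norm (\<lambda>x. v x - w x)"
    using ennreal_abs_le_sup_norm[of "\<lambda>x. u x - v x" x]
      ennreal_abs_le_sup_norm[of "\<lambda>x. v x - w x" x] by (rule add_mono)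
  finally show "ennreal \<bar>u x - w x\<bar> \<le> sup_norm (\<lambda>x. u x - v x) + sup_norm (\<lambda>x. v x - w x)" .
qed

lemma kappa_norm_diff_finite:
  assumes "u \<in> C_kappa \<kappa>" "v \<in> C_kappa \<kappa>"
  shows "kappa_norm \<kappa> (\<lambda>x. u x - v x) < \<infinity>"
proof -
  have "sup_norm (\<lambda>x. \<kappa> x * u x - \<kappa> x * v x)
      \<le> sup_norm (\<lambda>x. \<kappa> x * u x - 0) + sup_norm (\<lambda>x. 0 - \<kappa> x * v x)"
    by (rule sup_norm_diff_triangle)
  also have "\<dots> = kappa_norm \<kappa> u + kappa_norm \<kappa> v"
    by (simp add: kappa_norm_def sup_norm_def)
  also have "\<dots> < \<infinity>"
    using assms by (simp add: C_kappa_def)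
  finally show ?thesis
    by (simp add: kappa_norm_def right_diff_distrib)
qed

lemma Metric_space_kappa_dist:
  assumes "\<And>x. 0 < \<kappa> x"
  shows "Metric_space (C_kappa \<kappa>) (kappa_dist \<kappa>)"
proof
  fix u v w :: "'a \<Rightarrow> real"
  show "0 \<le> kappa_dist \<kappa> u v"
    by (simp add: kappa_dist_def)
  show "kappa_dist \<kappa> u v = kappa_dist \<kappa> v u"
    by (simp add: kappa_dist_def kappa_norm_def sup_norm_def right_diff_distrib abs_minus_commute)
  assume u: "u \<in> C_kappa \<kappa>" and v: "v \<in> C_kappa \<kappa>"
  show "kappa_dist \<kappa> u v = 0 \<longleftrightarrow> u = v"
  proof
    assume "kappa_dist \<kappa> u v = 0"
    then have 0: "kappa_norm \<kappa> (\<lambda>x. u x - v x) = 0"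
      using kappa_norm_diff_finite[OF u v] by (auto simp: kappa_dist_def enn2real_eq_0_iff)
    show "u = v"
    proof
      fix x
      have "ennreal \<bar>\<kappa> x * (u x - v x)\<bar> \<le> 0"
        using ennreal_abs_le_sup_norm[of "\<lambda>x. \<kappa> x * (u x - v x)" x] 0
        by (simp add: kappa_norm_def)
      then show "u x = v x"
        using assms[of x] by (simp add: ennreal_eq_0_iff)
    qed
  qed (simp add: kappa_dist_def kappa_norm_def sup_norm_def)
  assume w: "w \<in> C_kappa \<kappa>"
  have "kappa_norm \<kappa> (\<lambda>x. u x - w x)
      \<le> kappa_norm \<kappa> (\<lambda>x. u x - v x) + kappa_norm \<kappa> (\<lambda>x. v x - w x)"
    using sup_norm_diff_triangle[of "\<lambda>x. \<kappa> x * u x" "\<lambda>x. \<kappa> x * w x" "\<lambda>x. \<kappa> x * v x"]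
    by (simp add: kappa_norm_def right_diff_distrib)
  then show "kappa_dist \<kappa> u w \<le> kappa_dist \<kappa> u v + kappa_dist \<kappa> v w"
    unfolding kappa_dist_def
    using kappa_norm_diff_finite[OF u v] kappa_norm_diff_finite[OF v w]
    by (subst enn2real_plus[symmetric]) (auto intro!: enn2real_mono)
qed

end

theory Submission
  imports Defs
begin

text \<open>
  Fix \<open>u\<close> and compare the envelope \<open>\<S>\<close> at the times \<open>s\<close> and \<open>s + h\<close>.  Inserting the point \<open>s\<close>
  into a partition of \<open>[0, s + h]\<close> only increases the associated operator, because every
  \<open>S i\<close> is a semigroup of monotone operators (\<open>foldr_sup_step_split\<close>).  So \<open>\<S>(s + h) u\<close> is
  the supremum of \<open>A (B u)\<close>, where \<open>A\<close> runs through the partition operators of \<open>[0, s]\<close> and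
  \<open>B\<close> through those of \<open>[0, h]\<close>, while \<open>\<S>(s) u\<close> is the supremum of \<open>A u\<close>.  All operators
  \<open>A\<close> have the same Lipschitz constant \<open>exp (\<alpha> * s)\<close> in the weighted norm, hence the distance of the
  two suprema is at most \<open>exp (\<alpha> * s)\<close> times the supremum of \<open>\<parallel>B u - u\<parallel>\<close> over \<open>B\<close>
  (\<open>envelope_increment\<close>).

  It remains to bound \<open>\<parallel>B u - u\<parallel>\<close> uniformly over the partitions of \<open>[0, h]\<close> as \<open>h\<close> tends
  to \<open>0\<close>.  For a bounded Lipschitz function, \<open>\<bar>u y - u x\<bar> \<le> L * \<delta> + 2 * sup \<bar>u\<bar> * \<phi> x y\<close> with
  the cutoff functions \<open>\<phi> x\<close>; applying the sublinear operator \<open>B\<close>, which fixes constants and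
  is dominated by \<open>\<S>(h)\<close>, gives \<open>\<bar>B u x - u x\<bar> \<le> L * \<delta> + 2 * sup \<bar>u\<bar> * \<S>(h) (\<phi> x) x\<close>
  (\<open>regular_op_deviation\<close>), and the assumption on the cutoff functions makes
  this small after multiplication by \<open>\<kappa> x\<close> (\<open>short_time_Lip_b\<close>).  Bounded Lipschitz functions
  are dense and the operators \<open>B\<close> are equicontinuous, so the same holds for every \<open>u\<close>
  (\<open>short_time\<close>).

  All the operators involved -- the linear \<open>S i t\<close>, their suprema over \<open>\<Lambda>\<close>, the compositions
  of these, and the envelope -- lie in one class, \<open>regular_op\<close>, which is closed under
  composition and under suprema.
\<close>

section \<open>The weighted space\<close>

lemma kappa_norm_le_iff:
  assumes "\<And>x. 0 < \<kappa> x" "0 \<le> C"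
  shows "kappa_norm \<kappa> u \<le> ennreal C \<longleftrightarrow> (\<forall>x. \<kappa> x * \<bar>u x\<bar> \<le> C)"
  using assms
  by (simp add: kappa_norm_def sup_norm_def SUP_le_iff abs_mult ennreal_le_iff abs_of_pos)

text \<open>The infimum that defines \<open>lip_norm\<close> is attained: a Lipschitz estimate with every constant
  \<open>L + d\<close>, \<open>d > 0\<close>, gives the estimate with \<open>L\<close>.\<close>

lemma lip_norm_le_imp_lipschitz:
  assumes "lip_norm u \<le> ennreal L" "0 \<le> L"
  shows "L-lipschitz_on UNIV u"
proof (rule lipschitz_onI)
  fix x y
  show "dist (u x) (u y) \<le> L * dist x y"
  proof (rule field_le_epsilon)
    fix e :: real assume e: "0 < e"
    define d where "d = e / (1 + dist x y)"
    have d: "0 < d" "d * dist x y \<le> e"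
      using e by (auto simp: d_def field_simps add_pos_nonneg)
    have "lip_norm u < ennreal (L + d)"
      using d(1) assms(2) by (intro le_less_trans[OF assms(1)] ennreal_lessI) auto
    then obtain K where K: "K-lipschitz_on UNIV u" "ennreal K < ennreal (L + d)"
      unfolding lip_norm_def Inf_less_iff by auto
    have "K \<le> L + d"
      using K(2) ennreal_less_iff[OF lipschitz_on_nonneg[OF K(1)], of "L + d"]
      by (simp del: ennreal_plus)
    then have "dist (u x) (u y) \<le> (L + d) * dist x y"
      using lipschitz_onD[OF K(1), of x y] mult_right_mono[of K "L + d" "dist x y"] by simp
    then show "dist (u x) (u y) \<le> L * dist x y + e"
      using d by (simp add: algebra_simps)
  qed
qed (use assms in auto)

locale weight =
  fixes \<kappa> :: "'a::metric_space \<Rightarrow> real"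
  assumes kappa_pos: "\<And>x. 0 < \<kappa> x"
    and kappa_cont: "continuous_on UNIV \<kappa>"
    and kappa_bounded: "bounded (range \<kappa>)"
begin

sublocale Metric_space "C_kappa \<kappa>" "kappa_dist \<kappa>"
  by (rule Metric_space_kappa_dist) (rule kappa_pos)

lemma bounded_kappa_obtain:
  obtains K where "0 < K" "\<And>x. \<kappa> x \<le> K"
proof -
  obtain K where "\<And>x. \<bar>\<kappa> x\<bar> \<le> K"
    using kappa_bounded by (auto simp: bounded_iff)
  then have "\<kappa> x \<le> \<bar>K\<bar> + 1" for x
    using abs_le_D1[of "\<kappa> x" K] by (meson abs_ge_self add_increasing2 order_trans zero_le_one)
  then show thesis
    using that[of "\<bar>K\<bar> + 1"] by simp
qed

lemma C_kappa_iff: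
  "u \<in> C_kappa \<kappa> \<longleftrightarrow> continuous_on UNIV u \<and> (\<exists>C. \<forall>x. \<kappa> x * \<bar>u x\<bar> \<le> C)"
proof -
  have "(\<exists>C. \<forall>x. \<kappa> x * \<bar>u x\<bar> \<le> C)" if "kappa_norm \<kappa> u < \<infinity>"
    using kappa_norm_le_iff[of \<kappa> "enn2real (kappa_norm \<kappa> u)" u] kappa_pos that by auto
  moreover have "kappa_norm \<kappa> u < \<infinity>" if "\<forall>x. \<kappa> x * \<bar>u x\<bar> \<le> C" for C
  proof -
    have "kappa_norm \<kappa> u \<le> ennreal \<bar>C\<bar>"
      using kappa_norm_le_iff[of \<kappa> "\<bar>C\<bar>" u] kappa_pos that by (meson abs_ge_self abs_ge_zero order_trans)
    then show ?thesis
      unfolding infinity_ennreal_def by (rule le_less_trans[OF _ ennreal_less_top])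
  qed
  ultimately show ?thesis
    by (auto simp: C_kappa_def)
qed

lemma kappa_dist_le_iff:
  assumes "u \<in> C_kappa \<kappa>" "v \<in> C_kappa \<kappa>" "0 \<le> C"
  shows "kappa_dist \<kappa> u v \<le> C \<longleftrightarrow> (\<forall>x. \<kappa> x * \<bar>u x - v x\<bar> \<le> C)"
proof -
  have "kappa_dist \<kappa> u v \<le> C \<longleftrightarrow> kappa_norm \<kappa> (\<lambda>x. u x - v x) \<le> ennreal C"
    unfolding kappa_dist_def using kappa_norm_diff_finite[OF assms(1,2)] assms(3)
    by (metis enn2real_leI ennreal_enn2real ennreal_leI infinity_ennreal_def)
  then show ?thesis
    using kappa_norm_le_iff[of \<kappa> C "\<lambda>x. u x - v x"] kappa_pos assms(3) by simp
qed

lemma Lip_b_subset_C_kappa: "Lip_b \<subseteq> C_kappa \<kappa>"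
proof
  fix u :: "'a \<Rightarrow> real" assume u: "u \<in> Lip_b"
  then obtain B L where B: "\<And>x. \<bar>u x\<bar> \<le> B" and L: "L-lipschitz_on UNIV u"
    by (auto simp: Lip_b_def bounded_iff)
  obtain K where K: "0 < K" "\<And>x. \<kappa> x \<le> K"
    using bounded_kappa_obtain by blast
  have "\<kappa> x * \<bar>u x\<bar> \<le> K * B" for x
    using K B by (intro mult_mono) auto
  then show "u \<in> C_kappa \<kappa>"
    using lipschitz_on_continuous_on[OF L] by (auto simp: C_kappa_iff)
qed

text \<open>Multiplication by \<open>\<kappa>\<close> turns approximation in the weighted norm into uniform
  approximation, and dividing by the positive continuous weight afterwards preserves
  continuity.  So the approximation property alone already forces \<open>u\<close> to be continuous
  with finite norm.\<close>

lemma UC_kappa_iff: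
  "u \<in> UC_kappa \<kappa> \<longleftrightarrow> (\<forall>\<epsilon>>0. \<exists>v\<in>Lip_b. \<forall>x. \<kappa> x * \<bar>u x - v x\<bar> \<le> \<epsilon>)"
proof
  assume "u \<in> UC_kappa \<kappa>"
  then have u: "u \<in> C_kappa \<kappa>" "\<And>r. r > 0 \<Longrightarrow> \<exists>v\<in>Lip_b. v \<in> mcball u r"
    by (auto simp: UC_kappa_def kappa_topology_def metric_closure_of_alt)
  show "\<forall>\<epsilon>>0. \<exists>v\<in>Lip_b. \<forall>x. \<kappa> x * \<bar>u x - v x\<bar> \<le> \<epsilon>"
    using u(2) kappa_dist_le_iff[OF u(1)] by (meson in_mcball less_imp_le)
next
  assume approx: "\<forall>\<epsilon>>0. \<exists>v\<in>Lip_b. \<forall>x. \<kappa> x * \<bar>u x - v x\<bar> \<le> \<epsilon>"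
  have "\<forall>n. \<exists>v\<in>Lip_b. \<forall>x. \<kappa> x * \<bar>u x - v x\<bar> \<le> inverse (real (Suc n))"
    using approx by simp
  then obtain v where v: "\<And>n. v n \<in> Lip_b"
      and uv: "\<And>n x. \<kappa> x * \<bar>u x - v n x\<bar> \<le> inverse (real (Suc n))"
    by metis
  have v_C: "continuous_on UNIV (v n)" "\<exists>C. \<forall>x. \<kappa> x * \<bar>v n x\<bar> \<le> C" for n
    using subsetD[OF Lip_b_subset_C_kappa v, of n] by (simp_all add: C_kappa_iff)
  have "uniform_limit UNIV (\<lambda>n x. \<kappa> x * v n x) (\<lambda>x. \<kappa> x * u x) sequentially"
  proof (rule uniform_limitI)
    fix e :: real assume "0 < e"
    then have "\<forall>\<^sub>F n in sequentially. inverse (real (Suc n)) < e"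
      using LIMSEQ_inverse_real_of_nat order_tendstoD(2) by blast
    then show "\<forall>\<^sub>F n in sequentially. \<forall>x\<in>UNIV. dist (\<kappa> x * v n x) (\<kappa> x * u x) < e"
    proof eventually_elim
      case (elim n)
      have "dist (\<kappa> x * v n x) (\<kappa> x * u x) = \<kappa> x * \<bar>u x - v n x\<bar>" for x
        using kappa_pos[of x]
        by (simp add: dist_real_def abs_mult abs_minus_commute flip: right_diff_distrib)
      then show ?case
        using uv[of _ n] elim by (metis le_less_trans)
    qed
  qed
  then have "continuous_on UNIV (\<lambda>x. \<kappa> x * u x)"
    by (rule uniform_limit_theorem[rotated])
       (auto intro!: always_eventually continuous_intros kappa_cont v_C)
  then have "continuous_on UNIV (\<lambda>x. (\<kappa> x * u x) / \<kappa> x)"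
    using kappa_pos by (intro continuous_on_divide kappa_cont) (auto simp: less_imp_neq[symmetric])
  moreover have "(\<lambda>x. (\<kappa> x * u x) / \<kappa> x) = u"
    using kappa_pos by (auto simp: less_imp_neq[symmetric])
  ultimately have cont: "continuous_on UNIV u"
    by metis
  obtain C where C: "\<And>x. \<kappa> x * \<bar>v 0 x\<bar> \<le> C"
    using v_C(2) by blast
  have "\<kappa> x * \<bar>u x\<bar> \<le> 1 + C" for x
  proof -
    have "\<kappa> x * \<bar>u x\<bar> \<le> \<kappa> x * (\<bar>u x - v 0 x\<bar> + \<bar>v 0 x\<bar>)"
      using kappa_pos[of x] by (intro mult_left_mono) auto
    then show ?thesis
      using uv[of x 0] C[of x] by (simp add: distrib_left)
  qed
  then have u: "u \<in> C_kappa \<kappa>"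
    using cont by (auto simp: C_kappa_iff)
  have "\<exists>v\<in>Lip_b. v \<in> mcball u r" if "r > 0" for r
    using approx that u Lip_b_subset_C_kappa kappa_dist_le_iff[OF u]
    by (metis in_mcball less_imp_le subsetD)
  then show "u \<in> UC_kappa \<kappa>"
    using u by (auto simp: UC_kappa_def kappa_topology_def metric_closure_of_alt)
qed

lemma UC_kappa_subset_C_kappa: "UC_kappa \<kappa> \<subseteq> C_kappa \<kappa>"
  by (auto simp: UC_kappa_def kappa_topology_def metric_closure_of_alt)

lemma Lip_b_subset_UC_kappa: "Lip_b \<subseteq> UC_kappa \<kappa>"
proof
  fix u :: "'a \<Rightarrow> real" assume "u \<in> Lip_b"
  then show "u \<in> UC_kappa \<kappa>"
    unfolding UC_kappa_iff by (intro allI impI bexI[of _ u]) simp_all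
qed

lemma UC_kappa_bounded:
  assumes "u \<in> UC_kappa \<kappa>"
  obtains C where "\<And>x. \<kappa> x * \<bar>u x\<bar> \<le> C"
  using subsetD[OF UC_kappa_subset_C_kappa assms] unfolding C_kappa_iff by blast

lemma const_in_Lip_b: "(\<lambda>x. c) \<in> Lip_b"
  using lipschitz_on_constant[of UNIV c] by (auto simp: Lip_b_def)

lemmas const_in_UC_kappa = subsetD[OF Lip_b_subset_UC_kappa const_in_Lip_b]

lemma Lip_b_add: "u \<in> Lip_b \<Longrightarrow> v \<in> Lip_b \<Longrightarrow> (\<lambda>x. u x + v x :: real) \<in> Lip_b"
  by (auto simp: Lip_b_def intro!: bounded_plus_comp intro: lipschitz_on_add)

lemma Lip_b_scale: "u \<in> Lip_b \<Longrightarrow> (\<lambda>x. c * u x :: real) \<in> Lip_b"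
  using bounded_scaleR_comp[of u UNIV c]
  by (auto simp: Lip_b_def intro: lipschitz_on_cmult_real)


lemma Lip_b_abs_diff: "u \<in> Lip_b \<Longrightarrow> (\<lambda>x. \<bar>u x - c :: real\<bar>) \<in> Lip_b"
proof -
  assume "u \<in> Lip_b"
  then obtain B L where B: "\<And>x. \<bar>u x\<bar> \<le> B" and L: "L-lipschitz_on UNIV u"
    by (auto simp: Lip_b_def bounded_iff)
  have "\<bar>\<bar>u x - c\<bar>\<bar> \<le> B + \<bar>c\<bar>" for x
    using B[of x] by linarith
  then have "bounded (range (\<lambda>x. \<bar>u x - c\<bar>))"
    by (auto simp: bounded_iff)
  moreover have "L-lipschitz_on UNIV (\<lambda>x. \<bar>u x - c\<bar>)"
  proof (rule lipschitz_onI)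
    show "dist \<bar>u x - c\<bar> \<bar>u y - c\<bar> \<le> L * dist x y" for x y
      using lipschitz_onD[OF L, of x y] by (simp add: dist_real_def)
  qed (rule lipschitz_on_nonneg[OF L])
  ultimately show ?thesis
    by (auto simp: Lip_b_def)
qed

lemma UC_kappa_add:
  assumes "u \<in> UC_kappa \<kappa>" "v \<in> UC_kappa \<kappa>"
  shows "(\<lambda>x. u x + v x) \<in> UC_kappa \<kappa>"
  unfolding UC_kappa_iff
proof (intro allI impI)
  fix e :: real assume "0 < e"
  then obtain u' v' where *: "u' \<in> Lip_b" "\<And>x. \<kappa> x * \<bar>u x - u' x\<bar> \<le> e / 2"
      "v' \<in> Lip_b" "\<And>x. \<kappa> x * \<bar>v x - v' x\<bar> \<le> e / 2"
    using assms unfolding UC_kappa_iff by (meson half_gt_zero)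
  have "\<kappa> x * \<bar>u x + v x - (u' x + v' x)\<bar> \<le> e" for x
  proof -
    have "\<kappa> x * \<bar>u x + v x - (u' x + v' x)\<bar> \<le> \<kappa> x * (\<bar>u x - u' x\<bar> + \<bar>v x - v' x\<bar>)"
      using kappa_pos[of x] by (intro mult_left_mono) auto
    then show ?thesis
      using *(2,4)[of x] by (simp add: distrib_left)
  qed
  then show "\<exists>w\<in>Lip_b. \<forall>x. \<kappa> x * \<bar>u x + v x - w x\<bar> \<le> e"
    using Lip_b_add[OF *(1,3)] by (intro bexI[of _ "\<lambda>x. u' x + v' x"]) auto
qed

lemma UC_kappa_scale:
  assumes "u \<in> UC_kappa \<kappa>"
  shows "(\<lambda>x. c * u x) \<in> UC_kappa \<kappa>"
  unfolding UC_kappa_iff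
proof (intro allI impI)
  fix e :: real assume "0 < e"
  then have "0 < e / (\<bar>c\<bar> + 1)"
    by simp
  then obtain v where v: "v \<in> Lip_b" "\<And>x. \<kappa> x * \<bar>u x - v x\<bar> \<le> e / (\<bar>c\<bar> + 1)"
    using assms unfolding UC_kappa_iff by meson
  have "\<kappa> x * \<bar>c * u x - c * v x\<bar> \<le> e" for x
  proof -
    have "\<kappa> x * \<bar>c * u x - c * v x\<bar> = \<bar>c\<bar> * (\<kappa> x * \<bar>u x - v x\<bar>)"
      by (simp add: abs_mult flip: right_diff_distrib)
    also have "\<dots> \<le> (\<bar>c\<bar> + 1) * (e / (\<bar>c\<bar> + 1))"
      using v(2)[of x] kappa_pos[of x] by (intro mult_mono) auto
    finally show ?thesis
      by simp
  qed
  then show "\<exists>w\<in>Lip_b. \<forall>x. \<kappa> x * \<bar>c * u x - w x\<bar> \<le> e"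
    using Lip_b_scale[OF v(1)] by (intro bexI[of _ "\<lambda>x. c * v x"]) auto
qed

lemma UC_kappa_diff:
  "u \<in> UC_kappa \<kappa> \<Longrightarrow> v \<in> UC_kappa \<kappa> \<Longrightarrow> (\<lambda>x. u x - v x) \<in> UC_kappa \<kappa>"
  using UC_kappa_add[of u "\<lambda>x. - 1 * v x"] UC_kappa_scale[of v "- 1"] by simp

section \<open>Sublinear operators\<close>

text \<open>The class is chosen to be stable under composition and suprema and still strong enough
  to imply invariance of \<open>UC_kappa\<close> and Lipschitz continuity in the weighted norm.
  Sublinearity is stated through inequalities only, because these pass to compositions
  directly by monotonicity.  The constants \<open>a\<close> and \<open>b\<close> multiply along a composition, as
  \<open>exp (\<alpha> * t)\<close> and \<open>exp (\<beta> * t)\<close> do when times add up.\<close>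

definition regular_op :: "real \<Rightarrow> real \<Rightarrow> (('a \<Rightarrow> real) \<Rightarrow> 'a \<Rightarrow> real) \<Rightarrow> bool" where
  "regular_op a b A \<longleftrightarrow>
     (\<forall>u\<in>UC_kappa \<kappa>. \<forall>v\<in>UC_kappa \<kappa>. u \<le> v \<longrightarrow> A u \<le> A v) \<and>
     (\<forall>u\<in>UC_kappa \<kappa>. \<forall>v\<in>UC_kappa \<kappa>. \<forall>x. A (\<lambda>y. u y + v y) x \<le> A u x + A v x) \<and>
     (\<forall>u\<in>UC_kappa \<kappa>. \<forall>c\<ge>0. \<forall>x. A (\<lambda>y. c * u y) x \<le> c * A u x) \<and>
     (\<forall>c. A (\<lambda>x. c) = (\<lambda>x. c)) \<and>
     (\<forall>u\<in>UC_kappa \<kappa>. \<forall>C. (\<forall>x. \<kappa> x * \<bar>u x\<bar> \<le> C) \<longrightarrow> (\<forall>x. \<kappa> x * \<bar>A u x\<bar> \<le> a * C)) \<and>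
     (\<forall>u\<in>Lip_b. \<forall>L. L-lipschitz_on UNIV u \<longrightarrow> (b * L)-lipschitz_on UNIV (A u))"

context
  fixes a b A assumes A: "regular_op a b A"
begin

lemma regular_op_mono: "u \<in> UC_kappa \<kappa> \<Longrightarrow> v \<in> UC_kappa \<kappa> \<Longrightarrow> (\<And>y. u y \<le> v y) \<Longrightarrow> A u x \<le> A v x"
  using A by (auto simp: regular_op_def le_fun_def)

lemma regular_op_add:
  "u \<in> UC_kappa \<kappa> \<Longrightarrow> v \<in> UC_kappa \<kappa> \<Longrightarrow> A (\<lambda>y. u y + v y) x \<le> A u x + A v x"
  using A by (auto simp: regular_op_def)

lemma regular_op_scale: "u \<in> UC_kappa \<kappa> \<Longrightarrow> 0 \<le> c \<Longrightarrow> A (\<lambda>y. c * u y) x \<le> c * A u x"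
  using A by (auto simp: regular_op_def)

lemma regular_op_const: "A (\<lambda>x. c) = (\<lambda>x. c)"
  using A by (auto simp: regular_op_def)

lemma regular_op_bound:
  "u \<in> UC_kappa \<kappa> \<Longrightarrow> (\<And>x. \<kappa> x * \<bar>u x\<bar> \<le> C) \<Longrightarrow> \<kappa> x * \<bar>A u x\<bar> \<le> a * C"
  using A unfolding regular_op_def by blast

lemma regular_op_lipschitz:
  "u \<in> Lip_b \<Longrightarrow> L-lipschitz_on UNIV u \<Longrightarrow> (b * L)-lipschitz_on UNIV (A u)"
  using A unfolding regular_op_def by blast

text \<open>Boundedness is preserved because \<open>A\<close> is monotone and fixes the constants between which
  \<open>u\<close> lies.\<close>

lemma regular_op_Lip_b:
  assumes u: "u \<in> Lip_b"
  shows "A u \<in> Lip_b"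
proof -
  obtain B L where B: "\<And>x. \<bar>u x\<bar> \<le> B" and L: "L-lipschitz_on UNIV u"
    using u by (auto simp: Lip_b_def bounded_iff)
  have u_UC: "u \<in> UC_kappa \<kappa>"
    using u Lip_b_subset_UC_kappa by blast
  have "A u x \<le> B" "- B \<le> A u x" for x
    using regular_op_mono[OF u_UC const_in_UC_kappa, of B x]
      regular_op_mono[OF const_in_UC_kappa u_UC, of "- B" x] B
    by (auto simp: regular_op_const abs_le_iff minus_le_iff)
  then have "\<bar>A u x\<bar> \<le> B" for x
    by (simp add: abs_le_iff minus_le_iff)
  then show ?thesis
    using regular_op_lipschitz[OF u L] by (auto simp: Lip_b_def bounded_iff)
qed

text \<open>Subadditivity gives \<open>A u - A v \<le> A (u - v)\<close> and \<open>A v - A u \<le> A (v - u)\<close>, and the norm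
  bound applies to both right-hand sides.\<close>

lemma regular_op_diff_bound:
  assumes u: "u \<in> UC_kappa \<kappa>" and v: "v \<in> UC_kappa \<kappa>"
    and C: "\<And>x. \<kappa> x * \<bar>u x - v x\<bar> \<le> C"
  shows "\<kappa> x * \<bar>A u x - A v x\<bar> \<le> a * C"
proof -
  have "\<kappa> x * (A f x - A g x) \<le> a * C"
    if f: "f \<in> UC_kappa \<kappa>" and g: "g \<in> UC_kappa \<kappa>" and fg: "\<And>x. \<kappa> x * \<bar>f x - g x\<bar> \<le> C" for f g
  proof -
    have "A f x \<le> A (\<lambda>y. f y - g y) x + A g x"
      using regular_op_add[OF UC_kappa_diff[OF f g] g, of x] by simp
    then have "\<kappa> x * (A f x - A g x) \<le> \<kappa> x * \<bar>A (\<lambda>y. f y - g y) x\<bar>"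
      using kappa_pos[of x] by (intro mult_left_mono) auto
    also have "\<dots> \<le> a * C"
      by (rule regular_op_bound[OF UC_kappa_diff[OF f g] fg])
    finally show ?thesis .
  qed
  note one_sided = this
  have "\<kappa> x * (A u x - A v x) \<le> a * C"
    by (rule one_sided[OF u v C])
  moreover have "\<kappa> x * (A v x - A u x) \<le> a * C"
    by (rule one_sided[OF v u]) (use C in \<open>simp add: abs_minus_commute\<close>)
  ultimately show ?thesis
    by (cases "A v x \<le> A u x") simp_all
qed

text \<open>\<open>A\<close> maps the dense set \<open>Lip_b\<close> to itself and is Lipschitz continuous in the weighted
  norm, so it maps the closure \<open>UC_kappa\<close> to itself.\<close>

lemma regular_op_UC_kappa:
  assumes u: "u \<in> UC_kappa \<kappa>"
  shows "A u \<in> UC_kappa \<kappa>"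
  unfolding UC_kappa_iff
proof (intro allI impI)
  fix e :: real assume e: "0 < e"
  then have "0 < e / (\<bar>a\<bar> + 1)"
    by simp
  then obtain v where v: "v \<in> Lip_b" "\<And>x. \<kappa> x * \<bar>u x - v x\<bar> \<le> e / (\<bar>a\<bar> + 1)"
    using u unfolding UC_kappa_iff by meson
  have "\<kappa> x * \<bar>A u x - A v x\<bar> \<le> a * (e / (\<bar>a\<bar> + 1))" for x
    using v Lip_b_subset_UC_kappa by (intro regular_op_diff_bound[OF u]) auto
  moreover have "a * (e / (\<bar>a\<bar> + 1)) \<le> e"
    using e by (auto simp: field_simps abs_if)
  ultimately show "\<exists>w\<in>Lip_b. \<forall>x. \<kappa> x * \<bar>A u x - w x\<bar> \<le> e"
    using regular_op_Lip_b[OF v(1)] by (intro bexI[of _ "A v"]) (auto intro: order_trans)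
qed

text \<open>Near \<open>x\<close> the oscillation \<open>\<bar>u y - u x\<bar>\<close> is controlled by the Lipschitz constant, and
  away from \<open>x\<close> by the supremum of \<open>u\<close>, where the cutoff function \<open>\<phi>\<close> equals \<open>1\<close>.  A
  sublinear monotone operator that fixes constants turns this pointwise bound into a bound
  for \<open>\<bar>A u x - u x\<bar>\<close>.\<close>

lemma regular_op_deviation:
  assumes u: "u \<in> Lip_b" and L: "L-lipschitz_on UNIV u" and B: "\<And>y. \<bar>u y\<bar> \<le> B"
    and \<phi>: "\<phi> \<in> UC_kappa \<kappa>" "\<And>y. 0 \<le> \<phi> y" "\<And>y. \<delta> \<le> dist x y \<Longrightarrow> \<phi> y = 1" and \<delta>: "0 \<le> \<delta>"
  shows "\<bar>A u x - u x\<bar> \<le> L * \<delta> + 2 * B * A \<phi> x"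
proof -
  define w where "w y = \<bar>u y - u x\<bar>" for y
  have L0: "0 \<le> L"
    by (rule lipschitz_on_nonneg[OF L])
  have B0: "0 \<le> B"
    using B[of x] by linarith
  have u_UC: "u \<in> UC_kappa \<kappa>"
    using u Lip_b_subset_UC_kappa by blast
  have w_UC: "w \<in> UC_kappa \<kappa>"
    unfolding w_def using Lip_b_abs_diff[OF u] Lip_b_subset_UC_kappa by blast
  have \<phi>_UC: "(\<lambda>y. 2 * B * \<phi> y) \<in> UC_kappa \<kappa>"
    by (rule UC_kappa_scale[OF \<phi>(1)])
  have w_le: "w y \<le> L * \<delta> + 2 * B * \<phi> y" for y
  proof (cases "\<delta> \<le> dist x y")
    case True
    then show ?thesis
      using B[of x] B[of y] \<phi>(3)[of y] mult_nonneg_nonneg[OF L0 \<delta>] by (simp add: w_def)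
  next
    case False
    have "w y \<le> L * dist x y"
      using lipschitz_onD[OF L, of x y] by (simp add: w_def dist_real_def abs_minus_commute)
    also have "\<dots> \<le> L * \<delta>"
      using False L0 by (intro mult_left_mono) auto
    also have "\<dots> \<le> L * \<delta> + 2 * B * \<phi> y"
      using \<phi>(2)[of y] B0 by simp
    finally show ?thesis .
  qed
  have "A w x \<le> A (\<lambda>y. L * \<delta> + 2 * B * \<phi> y) x"
    by (rule regular_op_mono[OF w_UC UC_kappa_add[OF const_in_UC_kappa \<phi>_UC] w_le])
  also have "\<dots> \<le> L * \<delta> + A (\<lambda>y. 2 * B * \<phi> y) x"
    using regular_op_add[OF const_in_UC_kappa \<phi>_UC, of "L * \<delta>" x] by (simp add: regular_op_const)
  also have "\<dots> \<le> L * \<delta> + 2 * B * A \<phi> x"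
    using regular_op_scale[OF \<phi>(1), of "2 * B" x] B0 by simp
  finally have w_bound: "A w x \<le> L * \<delta> + 2 * B * A \<phi> x" .
  have "A u x \<le> A (\<lambda>y. u x + w y) x"
    by (rule regular_op_mono[OF u_UC UC_kappa_add[OF const_in_UC_kappa w_UC]]) (auto simp: w_def)
  also have "\<dots> \<le> u x + A w x"
    using regular_op_add[OF const_in_UC_kappa w_UC, of "u x" x] by (simp add: regular_op_const)
  finally have upper: "A u x \<le> u x + A w x" .
  have "u x = A (\<lambda>y. u x) x"
    by (simp add: regular_op_const)
  also have "\<dots> \<le> A (\<lambda>y. u y + w y) x"
    by (rule regular_op_mono[OF const_in_UC_kappa UC_kappa_add[OF u_UC w_UC]]) (auto simp: w_def)
  also have "\<dots> \<le> A u x + A w x"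
    by (rule regular_op_add[OF u_UC w_UC])
  finally have "u x \<le> A u x + A w x" .
  with upper w_bound show ?thesis
    by linarith
qed

end

lemma regular_op_id: "regular_op 1 1 (\<lambda>u. u)"
  by (auto simp: regular_op_def)

lemma regular_op_compose:
  assumes A: "regular_op a b A" and B: "regular_op c d B"
  shows "regular_op (a * c) (b * d) (\<lambda>u. A (B u))"
proof -
  note B_UC = regular_op_UC_kappa[OF B]
  have "A (B (\<lambda>y. u y + v y)) x \<le> A (B u) x + A (B v) x"
    if u: "u \<in> UC_kappa \<kappa>" and v: "v \<in> UC_kappa \<kappa>" for u v x
  proof -
    have "A (B (\<lambda>y. u y + v y)) x \<le> A (\<lambda>y. B u y + B v y) x"
      by (rule regular_op_mono[OF A B_UC[OF UC_kappa_add[OF u v]] UC_kappa_add[OF B_UC[OF u] B_UC[OF v]]])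
         (rule regular_op_add[OF B u v])
    also have "\<dots> \<le> A (B u) x + A (B v) x"
      by (rule regular_op_add[OF A B_UC[OF u] B_UC[OF v]])
    finally show ?thesis .
  qed
  moreover have "A (B (\<lambda>y. k * u y)) x \<le> k * A (B u) x"
    if u: "u \<in> UC_kappa \<kappa>" and k: "0 \<le> k" for u k x
  proof -
    have "A (B (\<lambda>y. k * u y)) x \<le> A (\<lambda>y. k * B u y) x"
      by (rule regular_op_mono[OF A B_UC[OF UC_kappa_scale[OF u]] UC_kappa_scale[OF B_UC[OF u]]])
         (rule regular_op_scale[OF B u k])
    also have "\<dots> \<le> k * A (B u) x"
      by (rule regular_op_scale[OF A B_UC[OF u] k])
    finally show ?thesis .
  qed
  moreover have "\<kappa> x * \<bar>A (B u) x\<bar> \<le> a * c * C"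
    if "u \<in> UC_kappa \<kappa>" "\<forall>x. \<kappa> x * \<bar>u x\<bar> \<le> C" for u C x
    using regular_op_bound[OF A B_UC regular_op_bound[OF B]] that by (simp add: mult.assoc)
  moreover have "(b * d * L)-lipschitz_on UNIV (A (B u))"
    if "u \<in> Lip_b" "L-lipschitz_on UNIV u" for u L
    using regular_op_lipschitz[OF A regular_op_Lip_b[OF B] regular_op_lipschitz[OF B]] that
    by (simp add: mult.assoc)
  moreover have "A (B u) \<le> A (B v)"
    if "u \<in> UC_kappa \<kappa>" "v \<in> UC_kappa \<kappa>" "u \<le> v" for u v
    using that by (intro le_funI regular_op_mono[OF A] B_UC regular_op_mono[OF B]) (auto simp: le_fun_def)
  ultimately show ?thesis
    by (simp add: regular_op_def regular_op_const[OF A] regular_op_const[OF B])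
qed

context
  fixes J :: "'j set" and a b and A
  assumes J: "J \<noteq> {}" and A: "\<And>j. j \<in> J \<Longrightarrow> regular_op a b (A j)"
begin

text \<open>The common norm bound \<open>a\<close> makes the suprema finite at every point.\<close>

lemma regular_op_family_bdd_above:
  assumes u: "u \<in> UC_kappa \<kappa>"
  shows "bdd_above ((\<lambda>j. A j u x) ` J)"
proof -
  obtain C where C: "\<And>x. \<kappa> x * \<bar>u x\<bar> \<le> C"
    using UC_kappa_bounded[OF u] by blast
  have "A j u x \<le> a * C / \<kappa> x" if "j \<in> J" for j
  proof -
    have "\<kappa> x * A j u x \<le> \<kappa> x * \<bar>A j u x\<bar>"
      using kappa_pos[of x] by (intro mult_left_mono) auto
    then have "\<kappa> x * A j u x \<le> a * C"
      using regular_op_bound[OF A[OF that] u C, of x] by linarith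
    then show ?thesis
      using kappa_pos[of x] by (simp add: field_simps)
  qed
  then show ?thesis
    by (auto intro!: bdd_aboveI)
qed

lemma regular_op_SUP: "regular_op a b (\<lambda>u x. SUP j\<in>J. A j u x)"
proof -
  note upper = cSUP_upper[OF _ regular_op_family_bdd_above]
  note least = cSUP_least[OF J]
  obtain j0 where j0: "j0 \<in> J"
    using J by blast
  have "(SUP j\<in>J. A j u x) \<le> (SUP j\<in>J. A j v x)"
    if "u \<in> UC_kappa \<kappa>" "v \<in> UC_kappa \<kappa>" "u \<le> v" for u v x
    by (rule least) (use that in \<open>auto intro!: order_trans[OF regular_op_mono[OF A] upper] simp: le_fun_def\<close>)
  moreover have "(SUP j\<in>J. A j (\<lambda>y. u y + v y) x) \<le> (SUP j\<in>J. A j u x) + (SUP j\<in>J. A j v x)"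
    if "u \<in> UC_kappa \<kappa>" "v \<in> UC_kappa \<kappa>" for u v x
    by (rule least) (use that in \<open>auto intro!: order_trans[OF regular_op_add[OF A] add_mono[OF upper upper]]\<close>)
  moreover have "(SUP j\<in>J. A j (\<lambda>y. c * u y) x) \<le> c * (SUP j\<in>J. A j u x)"
    if "u \<in> UC_kappa \<kappa>" "0 \<le> c" for u c x
    by (rule least) (use that in \<open>auto intro!: order_trans[OF regular_op_scale[OF A] mult_left_mono[OF upper]]\<close>)
  moreover have "(SUP j\<in>J. A j (\<lambda>y. c) x) = c" for c :: real and x
  proof -
    have "(SUP j\<in>J. A j (\<lambda>y. c) x) = (SUP j\<in>J. c)"
      by (rule SUP_cong[OF refl]) (simp add: regular_op_const[OF A])
    then show ?thesis
      using J by simp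
  qed
  moreover have "\<kappa> x * \<bar>SUP j\<in>J. A j u x\<bar> \<le> a * C"
    if u: "u \<in> UC_kappa \<kappa>" and C: "\<forall>x. \<kappa> x * \<bar>u x\<bar> \<le> C" for u C x
  proof -
    have *: "\<bar>A j u x\<bar> \<le> a * C / \<kappa> x" if "j \<in> J" for j
      using regular_op_bound[OF A[OF that] u, of C x] C kappa_pos[of x] by (simp add: field_simps)
    have "(SUP j\<in>J. A j u x) \<le> a * C / \<kappa> x"
      by (rule least) (use * in \<open>auto simp: abs_le_iff\<close>)
    moreover have "- (a * C / \<kappa> x) \<le> (SUP j\<in>J. A j u x)"
      using *[OF j0] upper[OF j0 u, of x] by linarith
    ultimately have "\<bar>SUP j\<in>J. A j u x\<bar> \<le> a * C / \<kappa> x"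
      by linarith
    then show ?thesis
      using kappa_pos[of x] by (simp add: field_simps)
  qed
  moreover have "(b * L)-lipschitz_on UNIV (\<lambda>x. SUP j\<in>J. A j u x)"
    if u: "u \<in> Lip_b" and L: "L-lipschitz_on UNIV u" for u L
  proof (rule lipschitz_onI)
    have lip: "(b * L)-lipschitz_on UNIV (A j u)" if "j \<in> J" for j
      by (rule regular_op_lipschitz[OF A[OF that] u L])
    have one_sided: "(SUP j\<in>J. A j u x) \<le> (SUP j\<in>J. A j u y) + b * L * dist x y" for x y
    proof (rule least)
      fix j assume j: "j \<in> J"
      have "A j u x \<le> A j u y + b * L * dist x y"
        using lipschitz_onD[OF lip[OF j], of x y] by (auto simp: dist_real_def)
      then show "A j u x \<le> (SUP j\<in>J. A j u y) + b * L * dist x y"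
        using upper[OF j subsetD[OF Lip_b_subset_UC_kappa u], of y] by linarith
    qed
    show "dist (SUP j\<in>J. A j u x) (SUP j\<in>J. A j u y) \<le> b * L * dist x y" for x y
      using one_sided[of x y] one_sided[of y x] by (auto simp: dist_real_def dist_commute abs_le_iff)
    show "0 \<le> b * L"
      by (rule lipschitz_on_nonneg[OF lip[OF j0]])
  qed
  ultimately show ?thesis
    by (simp add: regular_op_def le_fun_def)
qed

end

end

section \<open>The operators generated by the semigroups\<close>

locale semigroup_family = weight \<kappa> for \<kappa> :: "'a::metric_space \<Rightarrow> real" +
  fixes \<Lambda> :: "'l set"
    and S :: "'l \<Rightarrow> real \<Rightarrow> ('a \<Rightarrow> real) \<Rightarrow> 'a \<Rightarrow> real"
    and \<alpha> \<beta> :: real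
  assumes Lambda_nonempty: "\<Lambda> \<noteq> {}"
    and feller: "\<And>i. i \<in> \<Lambda> \<Longrightarrow> feller_semigroup \<kappa> (S i)"
    and linear: "\<And>i t. i \<in> \<Lambda> \<Longrightarrow> 0 \<le> t \<Longrightarrow> linear_on_UC \<kappa> (S i t)"
    and one: "\<And>i t. i \<in> \<Lambda> \<Longrightarrow> 0 \<le> t \<Longrightarrow> S i t (\<lambda>x. 1) = (\<lambda>x. 1)"
    and kappa_bound: "\<And>i t u. i \<in> \<Lambda> \<Longrightarrow> 0 \<le> t \<Longrightarrow> u \<in> Lip_b \<Longrightarrow>
          kappa_norm \<kappa> (S i t u) \<le> ennreal (exp (\<alpha> * t)) * kappa_norm \<kappa> u"
    and lip_bound: "\<And>i t u. i \<in> \<Lambda> \<Longrightarrow> 0 \<le> t \<Longrightarrow> u \<in> Lip_b \<Longrightarrow>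
          lip_norm (S i t u) \<le> ennreal (exp (\<beta> * t)) * lip_norm u"
begin

lemma S_continuous:
  assumes i: "i \<in> \<Lambda>" and t: "0 \<le> t" and u: "u \<in> UC_kappa \<kappa>" and e: "0 < e"
  obtains r where "0 < r"
    "\<And>v. v \<in> UC_kappa \<kappa> \<Longrightarrow> kappa_dist \<kappa> u v < r \<Longrightarrow> kappa_dist \<kappa> (S i t u) (S i t v) < e"
proof -
  interpret UC: Submetric "C_kappa \<kappa>" "kappa_dist \<kappa>" "UC_kappa \<kappa>"
    by unfold_locales (rule UC_kappa_subset_C_kappa)
  have topology_eq: "UC_topology \<kappa> = UC.sub.mtopology"
    by (simp add: UC_topology_def kappa_topology_def UC.mtopology_submetric)
  have "continuous_map (UC_topology \<kappa>) (UC_topology \<kappa>) (S i t)"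
    using feller[OF i] t unfolding feller_semigroup_def by blast
  then have "\<exists>r>0. \<forall>v. v \<in> UC_kappa \<kappa> \<and> kappa_dist \<kappa> u v < r \<longrightarrow>
      kappa_dist \<kappa> (S i t u) (S i t v) < e"
    unfolding topology_eq UC.sub.metric_continuous_map[OF UC.sub.Metric_space_axioms]
    using u e by blast
  then show thesis
    using that by blast
qed

lemma S_UC_kappa: "i \<in> \<Lambda> \<Longrightarrow> 0 \<le> t \<Longrightarrow> u \<in> UC_kappa \<kappa> \<Longrightarrow> S i t u \<in> UC_kappa \<kappa>"
proof -
  assume "i \<in> \<Lambda>" "0 \<le> t" "u \<in> UC_kappa \<kappa>"
  then have "continuous_map (UC_topology \<kappa>) (UC_topology \<kappa>) (S i t)"
    using feller[of i] unfolding feller_semigroup_def by blast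
  moreover have "topspace (UC_topology \<kappa>) = UC_kappa \<kappa>"
    using UC_kappa_subset_C_kappa by (auto simp: UC_topology_def kappa_topology_def)
  ultimately show ?thesis
    using \<open>u \<in> UC_kappa \<kappa>\<close> by (auto simp: continuous_map_def)
qed

lemma S_bound_Lip_b:
  assumes i: "i \<in> \<Lambda>" and t: "0 \<le> t" and u: "u \<in> Lip_b" and C: "\<And>x. \<kappa> x * \<bar>u x\<bar> \<le> C"
  shows "\<kappa> x * \<bar>S i t u x\<bar> \<le> exp (\<alpha> * t) * C"
proof -
  have C0: "0 \<le> C"
    using order_trans[OF _ C[of x], of 0] kappa_pos[of x] by (simp add: less_imp_le)
  have "kappa_norm \<kappa> (S i t u) \<le> ennreal (exp (\<alpha> * t)) * kappa_norm \<kappa> u"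
    by (rule kappa_bound[OF i t u])
  also have "\<dots> \<le> ennreal (exp (\<alpha> * t)) * ennreal C"
    using kappa_norm_le_iff[of \<kappa> C u] kappa_pos C C0 by (intro mult_left_mono) auto
  also have "\<dots> = ennreal (exp (\<alpha> * t) * C)"
    using C0 by (simp add: ennreal_mult)
  finally show ?thesis
    using kappa_norm_le_iff[of \<kappa> "exp (\<alpha> * t) * C" "S i t u"] kappa_pos C0 by simp
qed

text \<open>The growth bound is assumed for bounded Lipschitz functions only; it passes to their
  closure because \<open>S i t\<close> is continuous there.\<close>

lemma S_bound:
  assumes i: "i \<in> \<Lambda>" and t: "0 \<le> t" and u: "u \<in> UC_kappa \<kappa>" and C: "\<And>x. \<kappa> x * \<bar>u x\<bar> \<le> C"
  shows "\<kappa> x * \<bar>S i t u x\<bar> \<le> exp (\<alpha> * t) * C"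
proof (rule field_le_epsilon)
  fix e :: real assume e: "0 < e"
  obtain r where r: "0 < r"
    "\<And>v. v \<in> UC_kappa \<kappa> \<Longrightarrow> kappa_dist \<kappa> u v < r \<Longrightarrow> kappa_dist \<kappa> (S i t u) (S i t v) < e / 2"
    using S_continuous[OF i t u, of "e / 2"] e by (metis half_gt_zero)
  \<comment> \<open>Half of the error comes from replacing \<open>S i t u\<close> by \<open>S i t v\<close>, half from the norm of
    \<open>v\<close> exceeding \<open>C\<close> by up to \<open>q\<close>.\<close>
  define q where "q = min (r / 2) (e / (2 * exp (\<alpha> * t)))"
  have q: "0 < q" "q < r" "exp (\<alpha> * t) * q \<le> e / 2"
  proof -
    show "0 < q" "q < r"
      using r(1) e by (auto simp: q_def min_def)
    have "exp (\<alpha> * t) * q \<le> exp (\<alpha> * t) * (e / (2 * exp (\<alpha> * t)))"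
      by (intro mult_left_mono) (auto simp: q_def)
    then show "exp (\<alpha> * t) * q \<le> e / 2"
      by simp
  qed
  obtain v where v: "v \<in> Lip_b" and uv: "\<And>x. \<kappa> x * \<bar>u x - v x\<bar> \<le> q"
    using u q(1) unfolding UC_kappa_iff by blast
  have v_UC: "v \<in> UC_kappa \<kappa>"
    using v Lip_b_subset_UC_kappa by blast
  note [simp] = subsetD[OF UC_kappa_subset_C_kappa]
  have "kappa_dist \<kappa> u v \<le> q"
    using kappa_dist_le_iff[of u v q] u v_UC q(1) uv by simp
  then have "kappa_dist \<kappa> (S i t u) (S i t v) \<le> e / 2"
    using r(2)[OF v_UC] q(2) by simp
  then have Suv: "\<kappa> x * \<bar>S i t u x - S i t v x\<bar> \<le> e / 2"
    using kappa_dist_le_iff[of "S i t u" "S i t v" "e / 2"] S_UC_kappa[OF i t] u v_UC e by simp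
  have "\<kappa> y * \<bar>v y\<bar> \<le> C + q" for y
  proof -
    have "\<kappa> y * \<bar>v y\<bar> \<le> \<kappa> y * (\<bar>u y\<bar> + \<bar>u y - v y\<bar>)"
      using kappa_pos[of y] by (intro mult_left_mono) auto
    then show ?thesis
      using C[of y] uv[of y] by (simp add: distrib_left)
  qed
  then have Sv: "\<kappa> x * \<bar>S i t v x\<bar> \<le> exp (\<alpha> * t) * (C + q)"
    by (rule S_bound_Lip_b[OF i t v])
  have "\<kappa> x * \<bar>S i t u x\<bar> \<le> \<kappa> x * (\<bar>S i t v x\<bar> + \<bar>S i t u x - S i t v x\<bar>)"
    using kappa_pos[of x] by (intro mult_left_mono) auto
  also have "\<dots> \<le> exp (\<alpha> * t) * (C + q) + e / 2"
    using Sv Suv by (simp add: distrib_left)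
  also have "\<dots> \<le> exp (\<alpha> * t) * C + e"
    using q(3) by (simp add: distrib_left)
  finally show "\<kappa> x * \<bar>S i t u x\<bar> \<le> exp (\<alpha> * t) * C + e" .
qed

lemma S_regular:
  assumes i: "i \<in> \<Lambda>" and t: "0 \<le> t"
  shows "regular_op (exp (\<alpha> * t)) (exp (\<beta> * t)) (S i t)"
proof -
  have scale: "S i t (\<lambda>y. c * u y) = (\<lambda>y. c * S i t u y)" if "u \<in> UC_kappa \<kappa>" for u c
    using linear[OF i t] that unfolding linear_on_UC_def by blast
  moreover have "S i t (\<lambda>x. c) = (\<lambda>x. c)" for c
    using scale[OF const_in_UC_kappa, of c 1] by (simp add: one[OF i t])
  moreover have "(exp (\<beta> * t) * L)-lipschitz_on UNIV (S i t u)"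
    if u: "u \<in> Lip_b" and L: "L-lipschitz_on UNIV u" for u L
  proof (rule lip_norm_le_imp_lipschitz)
    have "lip_norm u \<le> ennreal L"
      unfolding lip_norm_def using L by (intro Inf_lower) auto
    then have "ennreal (exp (\<beta> * t)) * lip_norm u \<le> ennreal (exp (\<beta> * t)) * ennreal L"
      by (intro mult_left_mono) auto
    then show "lip_norm (S i t u) \<le> ennreal (exp (\<beta> * t) * L)"
      using lip_bound[OF i t u] lipschitz_on_nonneg[OF L] by (simp add: ennreal_mult)
    show "0 \<le> exp (\<beta> * t) * L"
      using lipschitz_on_nonneg[OF L] by simp
  qed
  moreover have "S i t u \<le> S i t v"
    if "u \<in> UC_kappa \<kappa>" "v \<in> UC_kappa \<kappa>" "u \<le> v" for u v
    using feller[OF i] t that unfolding feller_semigroup_def by blast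
  moreover have "S i t (\<lambda>y. u y + v y) = (\<lambda>y. S i t u y + S i t v y)"
    if "u \<in> UC_kappa \<kappa>" "v \<in> UC_kappa \<kappa>" for u v
    using linear[OF i t] that unfolding linear_on_UC_def by blast
  ultimately show ?thesis
    unfolding regular_op_def using S_bound[OF i t] by (intro conjI ballI allI impI) auto
qed

lemma sup_step_regular:
  assumes "0 \<le> h"
  shows "regular_op (exp (\<alpha> * h)) (exp (\<beta> * h)) (sup_step \<Lambda> S h)"
proof -
  have "sup_step \<Lambda> S h = (\<lambda>u x. SUP i\<in>\<Lambda>. S i h u x)"
    by (intro ext) (simp add: sup_step_def)
  then show ?thesis
    by (simp only:) (intro regular_op_SUP[OF Lambda_nonempty] S_regular assms)
qed

lemma S_le_sup_step:
  assumes "i \<in> \<Lambda>" "0 \<le> h" "u \<in> UC_kappa \<kappa>"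
  shows "S i h u x \<le> sup_step \<Lambda> S h u x"
  unfolding sup_step_def
  using assms by (intro cSUP_upper regular_op_family_bdd_above[OF Lambda_nonempty S_regular])

text \<open>Taking the supremum over \<open>\<Lambda>\<close> at an additional intermediate time can only increase the
  result, since every \<open>S i\<close> is a semigroup of monotone operators.\<close>

lemma sup_step_add_le:
  assumes s: "0 \<le> s" and h: "0 \<le> h" and u: "u \<in> UC_kappa \<kappa>"
  shows "sup_step \<Lambda> S (s + h) u x \<le> sup_step \<Lambda> S s (sup_step \<Lambda> S h u) x"
  unfolding sup_step_def[of \<Lambda> S "s + h"]
proof (rule cSUP_least[OF Lambda_nonempty])
  fix i assume i: "i \<in> \<Lambda>"
  have E_UC: "sup_step \<Lambda> S h u \<in> UC_kappa \<kappa>"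
    by (rule regular_op_UC_kappa[OF sup_step_regular[OF h] u])
  have "S i (s + h) u x = S i s (S i h u) x"
    using feller[OF i] s h u by (simp add: feller_semigroup_def)
  also have "\<dots> \<le> S i s (sup_step \<Lambda> S h u) x"
    by (rule regular_op_mono[OF S_regular[OF i s] S_UC_kappa[OF i h u] E_UC])
       (rule S_le_sup_step[OF i h u])
  also have "\<dots> \<le> sup_step \<Lambda> S s (sup_step \<Lambda> S h u) x"
    by (rule S_le_sup_step[OF i s E_UC])
  finally show "S i (s + h) u x \<le> sup_step \<Lambda> S s (sup_step \<Lambda> S h u) x" .
qed

end

section \<open>Partitions as lists of increments\<close>

text \<open>A partition with maximum \<open>t\<close> is determined by the list of its consecutive gaps, and the
  associated operator depends on the gaps only.  In this form, splitting and joining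
  partitions is splitting and appending lists.\<close>

definition increment_lists :: "real \<Rightarrow> real list set" where
  "increment_lists t = {hs. (\<forall>h\<in>set hs. 0 < h) \<and> sum_list hs = t}"

fun increments :: "real list \<Rightarrow> real list" where
  "increments (s # t # ts) = (t - s) # increments (t # ts)"
| "increments _ = []"

fun partial_sums :: "real \<Rightarrow> real list \<Rightarrow> real list" where
  "partial_sums c [] = [c]"
| "partial_sums c (h # hs) = c # partial_sums (c + h) hs"

lemma sup_steps_eq_foldr: "sup_steps \<Lambda> S ts u = foldr (sup_step \<Lambda> S) (increments ts) u"
  by (induction \<Lambda> S ts u rule: sup_steps.induct) auto

lemma increments_strict_sorted:
  "sorted_wrt (<) ts \<Longrightarrow> ts \<noteq> [] \<Longrightarrow> increments ts \<in> increment_lists (last ts - hd ts)"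
  by (induction ts rule: increments.induct) (auto simp: increment_lists_def)

lemma partial_sums_neq_Nil [simp]: "partial_sums c hs \<noteq> []"
  by (cases hs) auto

lemma hd_partial_sums [simp]: "hd (partial_sums c hs) = c"
  by (cases hs) auto

lemma increments_partial_sums: "increments (partial_sums c hs) = hs"
proof (induction hs arbitrary: c)
  case (Cons h hs)
  then show ?case
    using hd_partial_sums[of "c + h" hs] Cons.IH[of "c + h"]
    by (cases "partial_sums (c + h) hs") auto
qed simp

lemma last_partial_sums: "last (partial_sums c hs) = c + sum_list hs"
  by (induction hs arbitrary: c) auto

lemma partial_sums_ge: "\<forall>h\<in>set hs. 0 < h \<Longrightarrow> s \<in> set (partial_sums c hs) \<Longrightarrow> c \<le> s"
proof (induction hs arbitrary: c)
  case (Cons h hs)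
  consider "s = c" | "s \<in> set (partial_sums (c + h) hs)"
    using Cons.prems(2) by auto
  then show ?case
  proof cases
    case 2
    then have "c + h \<le> s"
      using Cons.prems(1) by (intro Cons.IH) simp_all
    then show ?thesis
      using Cons.prems(1) by (simp add: add_increasing2)
  qed simp
qed simp

lemma partial_sums_strict_sorted: "\<forall>h\<in>set hs. 0 < h \<Longrightarrow> sorted_wrt (<) (partial_sums c hs)"
proof (induction hs arbitrary: c)
  case (Cons h hs)
  have "c < s" if "s \<in> set (partial_sums (c + h) hs)" for s
    using partial_sums_ge[OF _ that] Cons.prems by (simp add: less_le_trans[of c "c + h"])
  then show ?case
    using Cons by simp
qed simp

lemma strict_sorted_le_last: "sorted_wrt (<) ts \<Longrightarrow> t \<in> set ts \<Longrightarrow> t \<le> (last ts :: real)"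
proof (induction ts)
  case (Cons a ts)
  then show ?case
    by (cases "ts = []") (auto simp: less_imp_le)
qed simp

lemma Max_strict_sorted: "sorted_wrt (<) ts \<Longrightarrow> ts \<noteq> [] \<Longrightarrow> Max (set ts) = (last ts :: real)"
  by (intro Max_eqI strict_sorted_le_last) auto

lemma hd_strict_sorted_le: "sorted_wrt (<) ts \<Longrightarrow> t \<in> set ts \<Longrightarrow> hd ts \<le> (t :: real)"
  by (cases ts) auto

text \<open>\<open>partial_sums 0\<close> recovers the sorted partition from its gaps.\<close>

lemma increments_image_partitions_to:
  "(\<lambda>\<pi>. increments (sorted_list_of_set \<pi>)) ` partitions_to t = increment_lists t"
proof (intro equalityI subsetI)
  fix hs assume "hs \<in> (\<lambda>\<pi>. increments (sorted_list_of_set \<pi>)) ` partitions_to t"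
  then obtain \<pi> where \<pi>: "finite \<pi>" "\<pi> \<subseteq> {0..}" "0 \<in> \<pi>" "Max \<pi> = t"
      and hs: "hs = increments (sorted_list_of_set \<pi>)"
    by (auto simp: partitions_to_def partitions_def)
  define ts where "ts = sorted_list_of_set \<pi>"
  have ts: "sorted_wrt (<) ts" "set ts = \<pi>"
    using \<pi>(1) by (auto simp: ts_def)
  then have ne: "ts \<noteq> []"
    using \<pi>(3) by auto
  have "hd ts = 0"
    using hd_strict_sorted_le[OF ts(1), of 0] hd_in_set[OF ne] ts(2) \<pi>(2,3) by fastforce
  then show "hs \<in> increment_lists t"
    using increments_strict_sorted[OF ts(1) ne] Max_strict_sorted[OF ts(1) ne] ts(2) \<pi>(4)
    by (simp add: hs ts_def)
next
  fix hs assume "hs \<in> increment_lists t"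
  then have hs: "\<forall>h\<in>set hs. 0 < h" "sum_list hs = t"
    by (auto simp: increment_lists_def)
  define ts where "ts = partial_sums 0 hs"
  have ts: "sorted_wrt (<) ts" "ts \<noteq> []" "hd ts = 0"
    using partial_sums_strict_sorted[OF hs(1)] by (auto simp: ts_def)
  have "Max (set ts) = t"
    using Max_strict_sorted[OF ts(1,2)] last_partial_sums[of 0 hs] hs(2) by (simp add: ts_def)
  moreover have "0 \<in> set ts" "set ts \<subseteq> {0..}"
    using hd_in_set[OF ts(2)] ts(3) partial_sums_ge[OF hs(1)] by (auto simp: ts_def)
  ultimately have "set ts \<in> partitions_to t"
    by (simp add: partitions_to_def partitions_def)
  moreover have "sorted_list_of_set (set ts) = ts"
    using ts(1) by (simp add: strict_sorted_iff sorted_list_of_set.idem_if_sorted_distinct)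
  ultimately show "hs \<in> (\<lambda>\<pi>. increments (sorted_list_of_set \<pi>)) ` partitions_to t"
    using increments_partial_sums[of 0 hs] by (force simp: ts_def)
qed

lemma semigroup_envelope_eq:
  "semigroup_envelope \<Lambda> S t u x = (SUP hs\<in>increment_lists t. foldr (sup_step \<Lambda> S) hs u x)"
  unfolding semigroup_envelope_def partition_op_def sup_steps_eq_foldr
    increments_image_partitions_to[symmetric] image_image ..

lemma increment_lists_nonempty: "0 \<le> t \<Longrightarrow> increment_lists t \<noteq> {}"
  by (cases "t = 0") (auto simp: increment_lists_def intro: exI[of _ "[]"] exI[of _ "[t]"])

lemma append_in_increment_lists:
  "as \<in> increment_lists s \<Longrightarrow> bs \<in> increment_lists h \<Longrightarrow> as @ bs \<in> increment_lists (s + h)"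
  by (auto simp: increment_lists_def)

section \<open>Strong continuity\<close>

context semigroup_family
begin

lemma foldr_sup_step_regular:
  assumes "hs \<in> increment_lists t"
  shows "regular_op (exp (\<alpha> * t)) (exp (\<beta> * t)) (foldr (sup_step \<Lambda> S) hs)"
  using assms
proof (induction hs arbitrary: t)
  case Nil
  then show ?case
    using regular_op_id by (simp add: increment_lists_def id_def)
next
  case (Cons h hs)
  then have h: "0 < h" and hs: "hs \<in> increment_lists (t - h)"
    by (auto simp: increment_lists_def)
  have "exp (c * h) * exp (c * (t - h)) = exp (c * t)" for c :: real
    by (simp add: right_diff_distrib flip: exp_add)
  moreover have "foldr (sup_step \<Lambda> S) (h # hs) = (\<lambda>u. sup_step \<Lambda> S h (foldr (sup_step \<Lambda> S) hs u))"
    by (simp add: comp_def)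
  ultimately show ?case
    using regular_op_compose[OF sup_step_regular[OF less_imp_le[OF h]] Cons.IH[OF hs]] by simp
qed

lemmas foldr_sup_step_UC_kappa = regular_op_UC_kappa[OF foldr_sup_step_regular]

lemma semigroup_envelope_regular:
  assumes "0 \<le> t"
  shows "regular_op (exp (\<alpha> * t)) (exp (\<beta> * t)) (semigroup_envelope \<Lambda> S t)"
proof -
  have "semigroup_envelope \<Lambda> S t = (\<lambda>u x. SUP hs\<in>increment_lists t. foldr (sup_step \<Lambda> S) hs u x)"
    by (intro ext) (rule semigroup_envelope_eq)
  then show ?thesis
    by (simp only:) (rule regular_op_SUP[OF increment_lists_nonempty[OF assms] foldr_sup_step_regular])
qed

lemma foldr_sup_step_le_envelope:
  assumes "0 \<le> t" "hs \<in> increment_lists t" "u \<in> UC_kappa \<kappa>"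
  shows "foldr (sup_step \<Lambda> S) hs u x \<le> semigroup_envelope \<Lambda> S t u x"
  unfolding semigroup_envelope_eq
  by (rule cSUP_upper[OF assms(2)
    regular_op_family_bdd_above[OF increment_lists_nonempty[OF assms(1)] foldr_sup_step_regular assms(3)]])

text \<open>If \<open>s\<close> is not a point of the partition, the gap around it is cut in two, which increases
  the operator by \<open>sup_step_add_le\<close>; the gaps before it act monotonically and preserve the
  inequality.\<close>

lemma foldr_sup_step_split:
  assumes "hs \<in> increment_lists (s + h)" "0 \<le> s" "0 \<le> h" and u: "u \<in> UC_kappa \<kappa>"
  shows "\<exists>as\<in>increment_lists s. \<exists>bs\<in>increment_lists h. \<forall>x.
    foldr (sup_step \<Lambda> S) hs u x \<le> foldr (sup_step \<Lambda> S) as (foldr (sup_step \<Lambda> S) bs u) x"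
  using assms(1,2)
proof (induction hs arbitrary: s)
  case Nil
  then have "s = 0" "h = 0"
    using \<open>0 \<le> h\<close> by (auto simp: increment_lists_def)
  then show ?case
    by (intro bexI[of _ "[]"]) (auto simp: increment_lists_def)
next
  case (Cons k ks)
  let ?E = "sup_step \<Lambda> S"
  have k: "0 < k" and ks: "ks \<in> increment_lists (s + h - k)"
    using Cons.prems(1) by (auto simp: increment_lists_def)
  have ks_UC: "foldr ?E ks u \<in> UC_kappa \<kappa>"
    by (rule foldr_sup_step_UC_kappa[OF ks u])
  consider "s = 0" | "0 < s" "s < k" | "k \<le> s"
    using Cons.prems(2) by linarith
  then show ?case
  proof cases
    case 1
    then show ?thesis
      using Cons.prems(1) by (intro bexI[of _ "[]"] bexI[of _ "k # ks"]) (auto simp: increment_lists_def)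
  next
    case 2
    have "[s] \<in> increment_lists s" "(k - s) # ks \<in> increment_lists h"
      using 2 ks by (auto simp: increment_lists_def)
    moreover have "foldr ?E (k # ks) u x \<le> foldr ?E [s] (foldr ?E ((k - s) # ks) u) x" for x
      using sup_step_add_le[of s "k - s", OF _ _ ks_UC] 2 by simp
    ultimately show ?thesis
      by blast
  next
    case 3
    have "ks \<in> increment_lists ((s - k) + h)"
      using ks by (simp add: algebra_simps)
    then obtain as bs where as: "as \<in> increment_lists (s - k)" and bs: "bs \<in> increment_lists h"
      and le: "\<And>x. foldr ?E ks u x \<le> foldr ?E as (foldr ?E bs u) x"
      using Cons.IH[of "s - k"] 3 by auto
    have "k # as \<in> increment_lists s"
      using as k by (auto simp: increment_lists_def)
    moreover have "foldr ?E (k # ks) u x \<le> foldr ?E (k # as) (foldr ?E bs u) x" for x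
      using k le regular_op_mono[OF sup_step_regular[of k] ks_UC
          foldr_sup_step_UC_kappa[OF as foldr_sup_step_UC_kappa[OF bs u]]] by simp
    ultimately show ?thesis
      using bs by blast
  qed
qed

text \<open>Both envelopes are suprema over the partitions \<open>as\<close> of \<open>[0, s]\<close>, followed by some \<open>bs\<close>
  in one of them.  Removing or adding \<open>bs\<close> costs at most \<open>exp (\<alpha> * s) * e\<close> in the weighted
  norm, uniformly in \<open>as\<close>.\<close>

lemma envelope_increment:
  assumes s: "0 \<le> s" and h: "0 \<le> h" and u: "u \<in> UC_kappa \<kappa>"
    and e: "\<And>bs x. bs \<in> increment_lists h \<Longrightarrow> \<kappa> x * \<bar>foldr (sup_step \<Lambda> S) bs u x - u x\<bar> \<le> e"
  shows "\<kappa> x * \<bar>semigroup_envelope \<Lambda> S (s + h) u x - semigroup_envelope \<Lambda> S s u x\<bar> \<le> exp (\<alpha> * s) * e"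
proof -
  let ?E = "foldr (sup_step \<Lambda> S)" and ?T = "semigroup_envelope \<Lambda> S"
  define c where "c = exp (\<alpha> * s) * e / \<kappa> x"
  have perturb: "\<bar>?E as (?E bs u) x - ?E as u x\<bar> \<le> c"
    if as: "as \<in> increment_lists s" and bs: "bs \<in> increment_lists h" for as bs
  proof -
    have "\<kappa> x * \<bar>?E as (?E bs u) x - ?E as u x\<bar> \<le> exp (\<alpha> * s) * e"
      by (rule regular_op_diff_bound[OF foldr_sup_step_regular[OF as]
            foldr_sup_step_UC_kappa[OF bs u] u e[OF bs]])
    then show ?thesis
      using kappa_pos[of x] by (simp add: c_def field_simps)
  qed
  have "?T (s + h) u x \<le> ?T s u x + c"
    unfolding semigroup_envelope_eq[of \<Lambda> S "s + h"]
  proof (rule cSUP_least)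
    show "increment_lists (s + h) \<noteq> {}"
      using s h by (intro increment_lists_nonempty) simp
    fix hs assume "hs \<in> increment_lists (s + h)"
    then obtain as bs where as: "as \<in> increment_lists s" and bs: "bs \<in> increment_lists h"
        and le: "?E hs u x \<le> ?E as (?E bs u) x"
      using foldr_sup_step_split[OF _ s h u] by blast
    show "?E hs u x \<le> ?T s u x + c"
      using le perturb[OF as bs] foldr_sup_step_le_envelope[OF s as u, of x] by linarith
  qed
  moreover have "?T s u x \<le> ?T (s + h) u x + c"
    unfolding semigroup_envelope_eq[of \<Lambda> S s]
  proof (rule cSUP_least[OF increment_lists_nonempty[OF s]])
    fix as assume as: "as \<in> increment_lists s"
    obtain bs where bs: "bs \<in> increment_lists h"
      using increment_lists_nonempty[OF h] by blast
    have "?E as (?E bs u) x \<le> ?T (s + h) u x"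
      using foldr_sup_step_le_envelope[OF _ append_in_increment_lists[OF as bs] u, of x] s h by simp
    then show "?E as u x \<le> ?T (s + h) u x + c"
      using perturb[OF as bs] by linarith
  qed
  ultimately have "\<bar>?T (s + h) u x - ?T s u x\<bar> \<le> c"
    by linarith
  then show ?thesis
    using kappa_pos[of x] by (simp add: c_def field_simps)
qed

context
  assumes cutoff: "\<And>\<delta>::real. 0 < \<delta> \<Longrightarrow>
          \<exists>\<phi> :: 'a \<Rightarrow> 'a \<Rightarrow> real.
            (\<forall>x. \<phi> x \<in> UC_kappa \<kappa>) \<and>
            (\<forall>x. (\<forall>y. 0 \<le> \<phi> x y \<and> \<phi> x y \<le> 1) \<and> \<phi> x x = 0 \<and>
                 (\<forall>y. \<delta> \<le> dist x y \<longrightarrow> \<phi> x y = 1)) \<and>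
            ((\<lambda>h. SUP x. \<kappa> x * semigroup_envelope \<Lambda> S h (\<phi> x) x) \<longlongrightarrow> 0) (at_right 0)"
begin

text \<open>The estimate of \<open>regular_op_deviation\<close> is uniform over all partitions of \<open>[0, h]\<close>, because
  each of their operators is dominated by the envelope on the cutoff function.\<close>

lemma short_time_Lip_b:
  assumes u: "u \<in> Lip_b" and e: "0 < e"
  shows "\<forall>\<^sub>F h in at_right 0. \<forall>hs\<in>increment_lists h. \<forall>x.
    \<kappa> x * \<bar>foldr (sup_step \<Lambda> S) hs u x - u x\<bar> \<le> e"
proof -
  obtain B0 L where "\<And>x. \<bar>u x\<bar> \<le> B0" and L: "L-lipschitz_on UNIV u"
    using u by (auto simp: Lip_b_def bounded_iff)
  moreover define B where "B = \<bar>B0\<bar> + 1"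
  ultimately have B: "\<And>x. \<bar>u x\<bar> \<le> B" "0 < B"
    by (auto intro: order_trans[of _ B0])
  obtain K where K: "0 < K" "\<And>x. \<kappa> x \<le> K"
    using bounded_kappa_obtain by blast
  have L0: "0 \<le> L"
    by (rule lipschitz_on_nonneg[OF L])
  \<comment> \<open>The denominator has \<open>L + 1\<close> in place of \<open>L\<close> because \<open>L\<close> may be \<open>0\<close>.\<close>
  define \<delta> where "\<delta> = e / (2 * K * (L + 1))"
  have \<delta>: "0 < \<delta>" "K * (L * \<delta>) \<le> e / 2"
  proof -
    show "0 < \<delta>"
      using e K(1) L0 by (simp add: \<delta>_def)
    have "K * ((L + 1) * \<delta>) = e / 2"
      using K(1) L0 by (simp add: \<delta>_def)
    moreover have "K * (L * \<delta>) \<le> K * ((L + 1) * \<delta>)"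
      using \<open>0 < \<delta>\<close> K(1) L0 by (intro mult_left_mono mult_right_mono) auto
    ultimately show "K * (L * \<delta>) \<le> e / 2"
      by simp
  qed
  obtain \<phi> :: "'a \<Rightarrow> 'a \<Rightarrow> real" where cut: "\<forall>x. \<phi> x \<in> UC_kappa \<kappa>"
      "\<forall>x. (\<forall>y. 0 \<le> \<phi> x y \<and> \<phi> x y \<le> 1) \<and> \<phi> x x = 0 \<and> (\<forall>y. \<delta> \<le> dist x y \<longrightarrow> \<phi> x y = 1)"
      and lim: "((\<lambda>h. SUP x. \<kappa> x * semigroup_envelope \<Lambda> S h (\<phi> x) x) \<longlongrightarrow> 0) (at_right 0)"
    using cutoff[OF \<delta>(1)] by (elim exE conjE)
  have \<phi>_UC: "\<phi> x \<in> UC_kappa \<kappa>" for x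
    using cut(1) ..
  have \<phi>: "0 \<le> \<phi> x y" "\<phi> x y \<le> 1" "\<delta> \<le> dist x y \<Longrightarrow> \<phi> x y = 1" for x y
    using cut(2) by blast+
  have "\<forall>\<^sub>F h in at_right 0. (SUP x. \<kappa> x * semigroup_envelope \<Lambda> S h (\<phi> x) x) < e / (4 * B)"
    using order_tendstoD(2)[OF lim] e B(2) by simp
  moreover have "\<forall>\<^sub>F h in at_right (0 :: real). 0 < h"
    by (rule eventually_at_right_less)
  ultimately show ?thesis
  proof eventually_elim
    case (elim h)
    show ?case
    proof (intro ballI allI)
      fix hs x assume hs: "hs \<in> increment_lists h"
      let ?A = "foldr (sup_step \<Lambda> S) hs" and ?T = "semigroup_envelope \<Lambda> S h"
      have h0: "0 \<le> h"
        using elim by simp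
      have "\<kappa> y * ?T (\<phi> y) y \<le> K" for y
      proof -
        have "?T (\<phi> y) y \<le> 1"
          using regular_op_mono[OF semigroup_envelope_regular[OF h0] \<phi>_UC const_in_UC_kappa, of y 1 y] \<phi>(2)
          by (simp add: regular_op_const[OF semigroup_envelope_regular[OF h0]])
        then show ?thesis
          using K(2)[of y] kappa_pos[of y] mult_left_mono[of "?T (\<phi> y) y" 1 "\<kappa> y"] by linarith
      qed
      then have "bdd_above (range (\<lambda>y. \<kappa> y * ?T (\<phi> y) y))"
        by (auto intro!: bdd_aboveI)
      then have "\<kappa> x * ?T (\<phi> x) x \<le> (SUP y. \<kappa> y * ?T (\<phi> y) y)"
        by (intro cSUP_upper) auto
      moreover have "\<kappa> x * ?A (\<phi> x) x \<le> \<kappa> x * ?T (\<phi> x) x"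
        using kappa_pos[of x] by (intro mult_left_mono foldr_sup_step_le_envelope[OF h0 hs \<phi>_UC]) auto
      ultimately have "\<kappa> x * ?A (\<phi> x) x \<le> e / (4 * B)"
        using elim by linarith
      then have far: "2 * B * (\<kappa> x * ?A (\<phi> x) x) \<le> e / 2"
        using B(2) by (simp add: field_simps)
      have "\<kappa> x * (L * \<delta>) \<le> K * (L * \<delta>)"
        using K(2) L0 \<delta>(1) by (intro mult_right_mono) auto
      then have near: "\<kappa> x * (L * \<delta>) \<le> e / 2"
        using \<delta>(2) by linarith
      have "\<bar>?A u x - u x\<bar> \<le> L * \<delta> + 2 * B * ?A (\<phi> x) x"
        using \<delta>(1) by (intro regular_op_deviation[OF foldr_sup_step_regular[OF hs] u L B(1) \<phi>_UC \<phi>(1,3)]) auto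
      then have "\<kappa> x * \<bar>?A u x - u x\<bar> \<le> \<kappa> x * (L * \<delta> + 2 * B * ?A (\<phi> x) x)"
        using kappa_pos[of x] by (intro mult_left_mono) auto
      also have "\<dots> = \<kappa> x * (L * \<delta>) + 2 * B * (\<kappa> x * ?A (\<phi> x) x)"
        by (simp add: algebra_simps)
      also have "\<dots> \<le> e"
        using near far by linarith
      finally show "\<kappa> x * \<bar>?A u x - u x\<bar> \<le> e" .
    qed
  qed
qed

text \<open>Approximation by bounded Lipschitz functions: for \<open>h < 1\<close> all operators have the common
  Lipschitz constant \<open>exp \<bar>\<alpha>\<bar>\<close> in the weighted norm.\<close>

lemma short_time:
  assumes u: "u \<in> UC_kappa \<kappa>" and e: "0 < e"
  shows "\<forall>\<^sub>F h in at_right 0. \<forall>hs\<in>increment_lists h. \<forall>x.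
    \<kappa> x * \<bar>foldr (sup_step \<Lambda> S) hs u x - u x\<bar> \<le> e"
proof -
  define q where "q = e / (2 * (exp \<bar>\<alpha>\<bar> + 1))"
  have q: "0 < q" "(exp \<bar>\<alpha>\<bar> + 1) * q = e / 2"
  proof -
    have pos: "0 < exp \<bar>\<alpha>\<bar> + 1"
      by (rule add_pos_pos[OF exp_gt_zero zero_less_one])
    then show "0 < q"
      using e by (simp add: q_def)
    have "c * (e / (2 * c)) = e / 2" if "0 < c" for c :: real
      using that by simp
    from this[OF pos] show "(exp \<bar>\<alpha>\<bar> + 1) * q = e / 2"
      unfolding q_def .
  qed
  obtain v where v: "v \<in> Lip_b" and uv: "\<And>x. \<kappa> x * \<bar>u x - v x\<bar> \<le> q"
    using u q(1) unfolding UC_kappa_iff by blast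
  have v_UC: "v \<in> UC_kappa \<kappa>"
    using v Lip_b_subset_UC_kappa by blast
  have "\<forall>\<^sub>F h in at_right 0. \<forall>hs\<in>increment_lists h. \<forall>x.
      \<kappa> x * \<bar>foldr (sup_step \<Lambda> S) hs v x - v x\<bar> \<le> e / 2"
    using e by (intro short_time_Lip_b[OF v]) simp
  moreover have "\<forall>\<^sub>F h in at_right (0 :: real). 0 < h \<and> h < 1"
    using zero_less_one unfolding eventually_at_right_field by blast
  ultimately show ?thesis
  proof eventually_elim
    case (elim h)
    show ?case
    proof (intro ballI allI)
      fix hs x assume hs: "hs \<in> increment_lists h"
      let ?A = "foldr (sup_step \<Lambda> S) hs"
      have "\<alpha> * h \<le> \<bar>\<alpha>\<bar> * 1"
        using elim(2) by (intro mult_mono) auto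
      then have "exp (\<alpha> * h) * q \<le> exp \<bar>\<alpha>\<bar> * q"
        using q(1) by simp
      then have Auv: "\<kappa> x * \<bar>?A u x - ?A v x\<bar> \<le> exp \<bar>\<alpha>\<bar> * q"
        using regular_op_diff_bound[OF foldr_sup_step_regular[OF hs] u v_UC uv, of x] by linarith
      have "\<kappa> x * \<bar>?A u x - u x\<bar> \<le> \<kappa> x * (\<bar>?A u x - ?A v x\<bar> + \<bar>?A v x - v x\<bar> + \<bar>u x - v x\<bar>)"
        using kappa_pos[of x] by (intro mult_left_mono) auto
      also have "\<dots> = \<kappa> x * \<bar>?A u x - ?A v x\<bar> + \<kappa> x * \<bar>?A v x - v x\<bar> + \<kappa> x * \<bar>u x - v x\<bar>"
        by (simp add: distrib_left)
      also have "\<dots> \<le> exp \<bar>\<alpha>\<bar> * q + e / 2 + q"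
        using Auv elim(1) hs uv[of x] by (intro add_mono) auto
      also have "\<dots> = e"
        using q(2) by (simp add: algebra_simps)
      finally show "\<kappa> x * \<bar>?A u x - u x\<bar> \<le> e" .
    qed
  qed
qed

lemma semigroup_envelope_strongly_continuous: "strongly_continuous \<kappa> (semigroup_envelope \<Lambda> S)"
  unfolding strongly_continuous_def
proof
  fix u assume u: "u \<in> UC_kappa \<kappa>"
  let ?T = "\<lambda>t. semigroup_envelope \<Lambda> S t u"
  have T_UC: "?T t \<in> UC_kappa \<kappa>" if "0 \<le> t" for t
    by (rule regular_op_UC_kappa[OF semigroup_envelope_regular[OF that] u])
  then have T_C: "?T t \<in> C_kappa \<kappa>" if "0 \<le> t" for t
    using that UC_kappa_subset_C_kappa by blast
  have "continuous_map (top_of_set {0..}) mtopology ?T"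
    unfolding continuous_map_to_metric
  proof (intro ballI allI impI)
    fix t e :: real
    assume "t \<in> topspace (top_of_set {0..})" and e: "0 < e"
    then have t: "0 \<le> t"
      by simp
    define q where "q = e / (2 * exp (\<bar>\<alpha>\<bar> * (t + 1)))"
    have q: "0 < q"
      using e by (simp add: q_def)
    obtain r where r: "0 < r" and short: "\<And>h hs x. 0 < h \<Longrightarrow> h < r \<Longrightarrow> hs \<in> increment_lists h \<Longrightarrow>
        \<kappa> x * \<bar>foldr (sup_step \<Lambda> S) hs u x - u x\<bar> \<le> q"
      using short_time[OF u q] by (auto simp: eventually_at_right_field)
    \<comment> \<open>Continuity from the left is obtained by stepping forward from the earlier time, so the
      estimate has to hold uniformly in starting points \<open>a\<close> near \<open>t\<close>.\<close>
    have forward: "kappa_dist \<kappa> (?T a) (?T b) \<le> e / 2"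
      if a: "0 \<le> a" "a < b" "b < a + r" "a \<le> t + 1" for a b
    proof -
      have "\<alpha> * a \<le> \<bar>\<alpha>\<bar> * (t + 1)"
        using a by (intro mult_mono) auto
      then have "exp (\<alpha> * a) * q \<le> exp (\<bar>\<alpha>\<bar> * (t + 1)) * q"
        using q by simp
      also have "\<dots> = e / 2"
        by (simp add: q_def)
      finally have small: "exp (\<alpha> * a) * q \<le> e / 2" .
      have "\<kappa> x * \<bar>?T (a + (b - a)) x - ?T a x\<bar> \<le> exp (\<alpha> * a) * q" for x
        using a by (intro envelope_increment[OF _ _ u] short) auto
      then have "\<kappa> x * \<bar>?T a x - ?T b x\<bar> \<le> exp (\<alpha> * a) * q" for x
        by (simp add: abs_minus_commute)
      then have "\<kappa> x * \<bar>?T a x - ?T b x\<bar> \<le> e / 2" for x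
        using small by (rule order_trans)
      then show ?thesis
        using kappa_dist_le_iff[of "?T a" "?T b" "e / 2"] T_C a e by simp
    qed
    define m where "m = min r 1"
    have "?T s \<in> mball (?T t) e" if s: "s \<in> {0..} \<inter> ball t m" for s
    proof -
      have s: "0 \<le> s" "\<bar>t - s\<bar> < r" "\<bar>t - s\<bar> < 1"
        using s by (auto simp: m_def dist_real_def)
      consider "s = t" | "s < t" | "t < s"
        by linarith
      then have "kappa_dist \<kappa> (?T t) (?T s) \<le> e / 2"
      proof cases
        case 1
        then show ?thesis
          using e T_C[OF t] by simp
      next
        case 2
        then show ?thesis
          using forward[of s t] s commute[of "?T s" "?T t"] by auto
      next
        case 3
        then show ?thesis
          using forward[of t s] s t by auto
      qed
      then show ?thesis
        using e T_C[OF t] T_C[OF s(1)] by auto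
    qed
    moreover have "openin (top_of_set {0..}) ({0..} \<inter> ball t m)"
      by (simp add: openin_open_Int)
    moreover have "t \<in> {0..} \<inter> ball t m"
      using t r by (simp add: m_def)
    ultimately show "\<exists>U. openin (top_of_set {0..}) U \<and> t \<in> U \<and> (\<forall>y\<in>U. ?T y \<in> mball (?T t) e)"
      by blast
  qed
  then show "continuous_map (top_of_set {0..}) (UC_topology \<kappa>) ?T"
    using T_UC by (auto simp: UC_topology_def kappa_topology_def continuous_map_in_subtopology)
qed

end

end

theorem proposition3p4:
  fixes \<Lambda> :: "'l set"
    and \<kappa> :: "'a::metric_space \<Rightarrow> real"
    and S :: "'l \<Rightarrow> real \<Rightarrow> ('a \<Rightarrow> real) \<Rightarrow> 'a \<Rightarrow> real"
    and \<alpha> \<beta> :: real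
  assumes Lambda_nonempty: "\<Lambda> \<noteq> {}"
    and separable: "separable_space (euclidean :: 'a topology)"
    and kappa_pos: "\<And>x. 0 < \<kappa> x"
    and kappa_cont: "continuous_on UNIV \<kappa>"
    and kappa_bounded: "bounded (range \<kappa>)"
    and feller: "\<And>i. i \<in> \<Lambda> \<Longrightarrow> feller_semigroup \<kappa> (S i)"
    and linear: "\<And>i t. i \<in> \<Lambda> \<Longrightarrow> 0 \<le> t \<Longrightarrow> linear_on_UC \<kappa> (S i t)"
    and one: "\<And>i t. i \<in> \<Lambda> \<Longrightarrow> 0 \<le> t \<Longrightarrow> S i t (\<lambda>x. 1) = (\<lambda>x. 1)"
    and kappa_bound: "\<And>i t u. i \<in> \<Lambda> \<Longrightarrow> 0 \<le> t \<Longrightarrow> u \<in> Lip_b \<Longrightarrow>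
          kappa_norm \<kappa> (S i t u) \<le> ennreal (exp (\<alpha> * t)) * kappa_norm \<kappa> u"
    and lip_bound: "\<And>i t u. i \<in> \<Lambda> \<Longrightarrow> 0 \<le> t \<Longrightarrow> u \<in> Lip_b \<Longrightarrow>
          lip_norm (S i t u) \<le> ennreal (exp (\<beta> * t)) * lip_norm u"
    and cutoff: "\<And>\<delta>::real. 0 < \<delta> \<Longrightarrow>
          \<exists>\<phi> :: 'a \<Rightarrow> 'a \<Rightarrow> real.
            (\<forall>x. \<phi> x \<in> UC_kappa \<kappa>) \<and>
            (\<forall>x. (\<forall>y. 0 \<le> \<phi> x y \<and> \<phi> x y \<le> 1) \<and> \<phi> x x = 0 \<and>
                 (\<forall>y. \<delta> \<le> dist x y \<longrightarrow> \<phi> x y = 1)) \<and>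
            ((\<lambda>h. SUP x. \<kappa> x * semigroup_envelope \<Lambda> S h (\<phi> x) x) \<longlongrightarrow> 0) (at_right 0)"
  shows "strongly_continuous \<kappa> (semigroup_envelope \<Lambda> S)"
proof -
  interpret semigroup_family \<kappa> \<Lambda> S \<alpha> \<beta>
    by unfold_locales (simp_all add: assms(1,3-10))
  show ?thesis
    by (rule semigroup_envelope_strongly_continuous) (rule cutoff)
qed

end
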